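(* If $C \overset{\omega}{\twoheadrightarrow} C'$ then there exists a finite configuration $x$ of the unitary event structure $[\![C]\!]$ with a covering chain $\emptyset\subset x_1\subset\cdots\subset x_n=x$ whose sequence of added events (read through their labels, with event $\tau_b^n$ read as $P_b^n$) is $\omega$.
   Context: Quantum commands over $N$ qubits: $C ::= \mathtt{skip} \mid U(\vec n) \mid C;C \mid \mathtt{meas}\ n\ C_1\ C_2 \mid C\parallel C$, where $U(\vec n)$ applies unitary $U$ to qubits $\vec n$, $\mathtt{meas}\ n\ C_1\ C_2$ measures qubit $n$ and continues with $C_1$ after projection $P_0^n$ and with $C_2$ after $P_1^n$, and $C_1\parallel C_2$ requires disjoint qubit sets. Labels: $sk$, $U(\vec n)$, $P_0^n$, $P_1^n$. Small steps: $\mathtt{skip}\xrightarrow{sk}\checkmark$, $U(\vec n)\xrightarrow{U(\vec n)}\checkmark$, $\mathtt{meas}\ n\ C_1\ C_2\xrightarrow{P_0^n}C_1$ and $\xrightarrow{P_1^n}C_2$; sequential and parallel composition as usual (left component of $;$ moves, reaching $\checkmark$ leaves $C_2$; either side of $\parallel$ moves, a finished side is dropped). Multi-step: $C\overset{l}{\twoheadrightarrow}C'$ if $C\xrightarrow{l}C'$; $C\overset{l:\omega'}{\twoheadrightarrow}C'$ if $C\xrightarrow{l}C''\overset{\omega'}{\twoheadrightarrow}C'$. A unitary event structure is an event structure $(E,\le,\#)$ (partial order with finite down-closures, hereditary conflict; configurations are conflict-free down-closed sets) with a map $Q$ from events to unitary or projection operators such that concurrent events have commuting operators, minimal conflict is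 transitive, and the sum of $Q$ over each minimal-conflict class is unitary. Interpretation $[\![C]\!]$: $[\![\mathtt{skip}]\!]$ is one event $sk$ with $Q=Id$; $[\![U(\vec n)]\!]$ is one event with $Q=U(\vec n)$; $[\![C_1;C_2]\!]$ has events $E_1\uplus(E_2\times$ maximal configurations of $[\![C_1]\!])$, with $e_1\le(e_2,x)$ for $e_1\in x$ and $Q$ inherited; $[\![\mathtt{meas}\ n\ C_1\ C_2]\!]$ has new events $\tau_0^n,\tau_1^n$ (with $Q=P_0^n,P_1^n$) in conflict, $\tau_0^n$ below all events of $[\![C_1]\!]$ and $\tau_1^n$ below all of $[\![C_2]\!]$, everything on the $\tau_0^n$ side in conflict with everything on the $\tau_1^n$ side; $[\![C_1\parallel C_2]\!]$ is the disjoint union. A covering chain of $x$ is a chain $\emptyset\subset x_1\subset\cdots\subset x_n=x$ of configurations each adding one event. *)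

theory Defs
  imports
    "Jordan_Normal_Form.Schur_Decomposition"
    "HOL-Library.FSet"
begin

section \<open>Operators on the space of \<open>N\<close> qubits\<close>

text \<open>
  Operators on \<open>N\<close> qubits are matrices of dimension \<open>2 ^ N\<close>. The computational basis vector with
  index \<open>i\<close> is the one in which qubit \<open>q\<close> has value \<open>bit i q\<close>.
\<close>

definition unitary_mat :: "nat \<Rightarrow> complex mat \<Rightarrow> bool" where
  "unitary_mat d U \<longleftrightarrow> U \<in> carrier_mat d d \<and> mat_adjoint U * U = 1\<^sub>m d \<and> U * mat_adjoint U = 1\<^sub>m d"

definition projection_mat :: "nat \<Rightarrow> complex mat \<Rightarrow> bool" where
  "projection_mat d P \<longleftrightarrow> P \<in> carrier_mat d d \<and> P * P = P \<and> mat_adjoint P = P"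

definition mat_sum :: "nat \<Rightarrow> ('e \<Rightarrow> complex mat) \<Rightarrow> 'e set \<Rightarrow> complex mat" where
  "mat_sum d f A = mat d d (\<lambda>ij. \<Sum>a\<in>A. f a $$ ij)"

definition agree_off :: "nat \<Rightarrow> nat set \<Rightarrow> nat \<Rightarrow> nat \<Rightarrow> bool" where
  "agree_off N S i j \<longleftrightarrow> (\<forall>q<N. q \<notin> S \<longrightarrow> bit i q = bit j q)"

definition sub_index :: "nat list \<Rightarrow> nat \<Rightarrow> nat" where
  "sub_index ns i = horner_sum of_bool 2 (map (bit i) ns)"

text \<open>
  The matrix \<open>U\<close>, of dimension \<open>2 ^ length ns\<close>, acting on the qubits \<open>ns\<close> and tensored with the
  identity on all other qubits. The \<open>p\<close>-th bit of an index of \<open>U\<close> is the value of qubit \<open>ns ! p\<close>.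
\<close>

definition on_qubits :: "nat \<Rightarrow> complex mat \<Rightarrow> nat list \<Rightarrow> complex mat" where
  "on_qubits N U ns = mat (2 ^ N) (2 ^ N) (\<lambda>(i, j).
     if agree_off N (set ns) i j then U $$ (sub_index ns i, sub_index ns j) else 0)"

definition ket_bra :: "bool \<Rightarrow> complex mat" where
  "ket_bra b = mat 2 2 (\<lambda>(i, j). of_bool (i = j \<and> i = of_bool b))"


section \<open>Quantum commands and their operational semantics\<close>

text \<open>Measurement outcomes are Booleans: \<open>False\<close> is \<open>0\<close> and \<open>True\<close> is \<open>1\<close>.\<close>

datatype com =
    Skip
  | Gate "complex mat" "nat list"
  | Seq com com
  | Meas nat com com
  | Par com com

datatype label =
    LSkip
  | LGate "complex mat" "nat list"
  | LProj bool nat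

primrec qubits :: "com \<Rightarrow> nat set" where
  "qubits Skip = {}"
| "qubits (Gate U ns) = set ns"
| "qubits (Seq C1 C2) = qubits C1 \<union> qubits C2"
| "qubits (Meas n C1 C2) = {n} \<union> qubits C1 \<union> qubits C2"
| "qubits (Par C1 C2) = qubits C1 \<union> qubits C2"

primrec wf_com :: "nat \<Rightarrow> com \<Rightarrow> bool" where
  "wf_com N Skip \<longleftrightarrow> True"
| "wf_com N (Gate U ns) \<longleftrightarrow>
     distinct ns \<and> set ns \<subseteq> {..<N} \<and> unitary_mat (2 ^ length ns) U"
| "wf_com N (Seq C1 C2) \<longleftrightarrow> wf_com N C1 \<and> wf_com N C2"
| "wf_com N (Meas n C1 C2) \<longleftrightarrow> n < N \<and> wf_com N C1 \<and> wf_com N C2"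
| "wf_com N (Par C1 C2) \<longleftrightarrow> wf_com N C1 \<and> wf_com N C2 \<and> qubits C1 \<inter> qubits C2 = {}"

primrec label_op :: "nat \<Rightarrow> label \<Rightarrow> complex mat" where
  "label_op N LSkip = 1\<^sub>m (2 ^ N)"
| "label_op N (LGate U ns) = on_qubits N U ns"
| "label_op N (LProj b n) = on_qubits N (ket_bra b) [n]"

datatype residual = Done (\<open>\<checkmark>\<close>) | Run com

inductive step :: "com \<Rightarrow> label \<Rightarrow> residual \<Rightarrow> bool" (\<open>_ \<rightarrow>[_] _\<close> [60, 0, 60] 55) where
  skip: "Skip \<rightarrow>[LSkip] \<checkmark>"
| gate: "Gate U ns \<rightarrow>[LGate U ns] \<checkmark>"
| meas0: "Meas n C1 C2 \<rightarrow>[LProj False n] Run C1"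
| meas1: "Meas n C1 C2 \<rightarrow>[LProj True n] Run C2"
| seq: "C1 \<rightarrow>[l] Run C1' \<Longrightarrow> Seq C1 C2 \<rightarrow>[l] Run (Seq C1' C2)"
| seq_done: "C1 \<rightarrow>[l] \<checkmark> \<Longrightarrow> Seq C1 C2 \<rightarrow>[l] Run C2"
| par_left: "C1 \<rightarrow>[l] Run C1' \<Longrightarrow> Par C1 C2 \<rightarrow>[l] Run (Par C1' C2)"
| par_left_done: "C1 \<rightarrow>[l] \<checkmark> \<Longrightarrow> Par C1 C2 \<rightarrow>[l] Run C2"
| par_right: "C2 \<rightarrow>[l] Run C2' \<Longrightarrow> Par C1 C2 \<rightarrow>[l] Run (Par C1 C2')"
| par_right_done: "C2 \<rightarrow>[l] \<checkmark> \<Longrightarrow> Par C1 C2 \<rightarrow>[l] Run C1"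

inductive steps :: "com \<Rightarrow> label list \<Rightarrow> residual \<Rightarrow> bool" (\<open>_ \<twoheadrightarrow>[_] _\<close> [60, 0, 60] 55) where
  single: "C \<rightarrow>[l] R \<Longrightarrow> C \<twoheadrightarrow>[[l]] R"
| cons: "C \<rightarrow>[l] Run C'' \<Longrightarrow> C'' \<twoheadrightarrow>[\<omega>] R \<Longrightarrow> C \<twoheadrightarrow>[l # \<omega>] R"


section \<open>Unitary event structures\<close>

record 'e es =
  events :: "'e set"
  causality :: "('e \<times> 'e) set"
  conflict :: "('e \<times> 'e) set"

record 'e ues = "'e es" +
  op :: "'e \<Rightarrow> complex mat"

definition event_structure :: "('e, 'z) es_scheme \<Rightarrow> bool" where
  "event_structure E \<longleftrightarrow>
     partial_order_on (events E) (causality E) \<and>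
     (\<forall>e\<in>events E. finite {d. (d, e) \<in> causality E}) \<and>
     conflict E \<subseteq> events E \<times> events E \<and> irrefl (conflict E) \<and> sym (conflict E) \<and>
     (\<forall>d e e'. (d, e) \<in> conflict E \<and> (e, e') \<in> causality E \<longrightarrow> (d, e') \<in> conflict E)"

definition configuration :: "('e, 'z) es_scheme \<Rightarrow> 'e set \<Rightarrow> bool" where
  "configuration E x \<longleftrightarrow> x \<subseteq> events E \<and>
     (\<forall>d e. e \<in> x \<and> (d, e) \<in> causality E \<longrightarrow> d \<in> x) \<and>
     (\<forall>d\<in>x. \<forall>e\<in>x. (d, e) \<notin> conflict E)"

definition maximal_configuration :: "('e, 'z) es_scheme \<Rightarrow> 'e set \<Rightarrow> bool" where
  "maximal_configuration E x \<longleftrightarrow>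
     configuration E x \<and> (\<forall>y. configuration E y \<and> x \<subseteq> y \<longrightarrow> y = x)"

text \<open>The list \<open>es\<close> is the sequence of events added along a covering chain
  \<open>{} = xs ! 0 \<subset> xs ! 1 \<subset> \<dots> \<subset> xs ! length es = x\<close> of configurations.\<close>

definition covering_chain :: "('e, 'z) es_scheme \<Rightarrow> 'e set \<Rightarrow> 'e list \<Rightarrow> bool" where
  "covering_chain E x es \<longleftrightarrow>
     (\<exists>xs. length xs = Suc (length es) \<and> xs ! 0 = {} \<and> xs ! length es = x \<and>
        (\<forall>i\<le>length es. configuration E (xs ! i)) \<and>
        (\<forall>i<length es. es ! i \<notin> xs ! i \<and> xs ! Suc i = insert (es ! i) (xs ! i)))"

definition concurrent :: "('e, 'z) es_scheme \<Rightarrow> 'e \<Rightarrow> 'e \<Rightarrow> bool" where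
  "concurrent E d e \<longleftrightarrow> d \<in> events E \<and> e \<in> events E \<and>
     (d, e) \<notin> causality E \<and> (e, d) \<notin> causality E \<and> (d, e) \<notin> conflict E"

definition minimal_conflict :: "('e, 'z) es_scheme \<Rightarrow> 'e \<Rightarrow> 'e \<Rightarrow> bool" where
  "minimal_conflict E d e \<longleftrightarrow> (d, e) \<in> conflict E \<and>
     (\<forall>d' e'. (d', d) \<in> causality E \<and> (e', e) \<in> causality E \<and> (d', e') \<in> conflict E
        \<longrightarrow> d' = d \<and> e' = e)"

text \<open>
  Conflict is irreflexive, so transitivity of minimal conflict can only be required up to equality:
  the reflexive closure of minimal conflict is an equivalence relation, and its equivalence classes
  are the minimal-conflict classes. An event in no minimal conflict forms a singleton class.
\<close>

definition conflict_class :: "('e, 'z) es_scheme \<Rightarrow> 'e \<Rightarrow> 'e set" where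
  "conflict_class E e = insert e {d. minimal_conflict E e d}"

definition unitary_event_structure :: "nat \<Rightarrow> ('e, 'z) ues_scheme \<Rightarrow> bool" where
  "unitary_event_structure N E \<longleftrightarrow> event_structure E \<and>
     (\<forall>e\<in>events E. unitary_mat (2 ^ N) (op E e) \<or> projection_mat (2 ^ N) (op E e)) \<and>
     (\<forall>d e. concurrent E d e \<longrightarrow> op E d * op E e = op E e * op E d) \<and>
     (\<forall>c d e. minimal_conflict E c d \<and> minimal_conflict E d e \<and> c \<noteq> e
        \<longrightarrow> minimal_conflict E c e) \<and>
     (\<forall>e\<in>events E. finite (conflict_class E e) \<and>
        unitary_mat (2 ^ N) (mat_sum (2 ^ N) (op E) (conflict_class E e)))"


section \<open>Interpretation of commands\<close>

text \<open>
  A single type holds the events of all commands. \<open>Tau b n\<close> is the event \<open>\<tau>\<close> of outcome \<open>b\<close> for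
  qubit \<open>n\<close>. \<open>Fst\<close> and \<open>Snd\<close> tag the events of the two components of a parallel composition or of
  the two branches of a measurement. In a sequential composition \<open>Fst\<close> tags the first component,
  and \<open>After e x\<close> is the pair of an event \<open>e\<close> of the second component and a maximal configuration
  \<open>x\<close> of the first one. Finite sets suffice for \<open>x\<close>, since every command has finitely many events:
  see \<open>finite_events_interp\<close>.
\<close>

datatype event =
    Ev_Skip
  | Ev_Gate "complex mat" "nat list"
  | Tau bool nat
  | Fst event
  | Snd event
  | After event "event fset"

primrec event_label :: "event \<Rightarrow> label" where
  "event_label Ev_Skip = LSkip"
| "event_label (Ev_Gate U ns) = LGate U ns"
| "event_label (Tau b n) = LProj b n"
| "event_label (Fst e) = event_label e"
| "event_label (Snd e) = event_label e"
| "event_label (After e x) = event_label e"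

definition single_ues :: "event \<Rightarrow> complex mat \<Rightarrow> event ues" where
  "single_ues e A = \<lparr>events = {e}, causality = {(e, e)}, conflict = {}, op = (\<lambda>_. A)\<rparr>"

text \<open>
  The conflict of a sequential composition is the one inherited from both components: two events
  of the second component are in conflict if they belong to the same copy and are in conflict there,
  or if their copies depend on conflicting events of the first component.
\<close>

definition seq_ues :: "event ues \<Rightarrow> event ues \<Rightarrow> event ues" where
  "seq_ues A B = \<lparr>
     events = Fst ` events A
       \<union> {After e x | e x. e \<in> events B \<and> maximal_configuration A (fset x)},
     causality = {(Fst d, Fst e) | d e. (d, e) \<in> causality A}
       \<union> {(Fst d, After e x) | d e x.
            d \<in> fset x \<and> e \<in> events B \<and> maximal_configuration A (fset x)}
       \<union> {(After d x, After e x) | d e x.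
            (d, e) \<in> causality B \<and> maximal_configuration A (fset x)},
     conflict = {(Fst d, Fst e) | d e. (d, e) \<in> conflict A}
       \<union> {(Fst d, After e x) | d e x. e \<in> events B \<and> maximal_configuration A (fset x)
            \<and> (\<exists>a\<in>fset x. (d, a) \<in> conflict A)}
       \<union> {(After e x, Fst d) | d e x. e \<in> events B \<and> maximal_configuration A (fset x)
            \<and> (\<exists>a\<in>fset x. (a, d) \<in> conflict A)}
       \<union> {(After d x, After e x) | d e x.
            (d, e) \<in> conflict B \<and> maximal_configuration A (fset x)}
       \<union> {(After d x, After e y) | d e x y. d \<in> events B \<and> e \<in> events B
            \<and> maximal_configuration A (fset x) \<and> maximal_configuration A (fset y)
            \<and> (\<exists>a\<in>fset x. \<exists>b\<in>fset y. (a, b) \<in> conflict A)},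
     op = (\<lambda>e. case e of Fst d \<Rightarrow> op A d | After d x \<Rightarrow> op B d)\<rparr>"

definition meas_ues :: "nat \<Rightarrow> nat \<Rightarrow> event ues \<Rightarrow> event ues \<Rightarrow> event ues" where
  "meas_ues N n A B =
     (let side0 = insert (Tau False n) (Fst ` events A);
          side1 = insert (Tau True n) (Snd ` events B)
      in \<lparr>
        events = side0 \<union> side1,
        causality = Pair (Tau False n) ` side0 \<union> {(Fst d, Fst e) | d e. (d, e) \<in> causality A}
          \<union> Pair (Tau True n) ` side1 \<union> {(Snd d, Snd e) | d e. (d, e) \<in> causality B},
        conflict = side0 \<times> side1 \<union> side1 \<times> side0
          \<union> {(Fst d, Fst e) | d e. (d, e) \<in> conflict A}
          \<union> {(Snd d, Snd e) | d e. (d, e) \<in> conflict B},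
        op = (\<lambda>e. case e of Tau b m \<Rightarrow> label_op N (LProj b m) | Fst d \<Rightarrow> op A d | Snd d \<Rightarrow> op B d)\<rparr>)"

definition par_ues :: "event ues \<Rightarrow> event ues \<Rightarrow> event ues" where
  "par_ues A B = \<lparr>
     events = Fst ` events A \<union> Snd ` events B,
     causality = {(Fst d, Fst e) | d e. (d, e) \<in> causality A}
       \<union> {(Snd d, Snd e) | d e. (d, e) \<in> causality B},
     conflict = {(Fst d, Fst e) | d e. (d, e) \<in> conflict A}
       \<union> {(Snd d, Snd e) | d e. (d, e) \<in> conflict B},
     op = (\<lambda>e. case e of Fst d \<Rightarrow> op A d | Snd d \<Rightarrow> op B d)\<rparr>"

primrec interp :: "com \<Rightarrow> nat \<Rightarrow> event ues" (\<open>\<lbrakk>_\<rbrakk>\<^bsub>_\<^esub>\<close>) where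
  "\<lbrakk>Skip\<rbrakk>\<^bsub>N\<^esub> = single_ues Ev_Skip (label_op N LSkip)"
| "\<lbrakk>Gate U ns\<rbrakk>\<^bsub>N\<^esub> = single_ues (Ev_Gate U ns) (label_op N (LGate U ns))"
| "\<lbrakk>Seq C1 C2\<rbrakk>\<^bsub>N\<^esub> = seq_ues \<lbrakk>C1\<rbrakk>\<^bsub>N\<^esub> \<lbrakk>C2\<rbrakk>\<^bsub>N\<^esub>"
| "\<lbrakk>Meas n C1 C2\<rbrakk>\<^bsub>N\<^esub> = meas_ues N n \<lbrakk>C1\<rbrakk>\<^bsub>N\<^esub> \<lbrakk>C2\<rbrakk>\<^bsub>N\<^esub>"
| "\<lbrakk>Par C1 C2\<rbrakk>\<^bsub>N\<^esub> = par_ues \<lbrakk>C1\<rbrakk>\<^bsub>N\<^esub> \<lbrakk>C2\<rbrakk>\<^bsub>N\<^esub>"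


section \<open>The interpretation of a command is a unitary event structure\<close>

lemma adjoint_index:
  assumes "A \<in> carrier_mat n m" "i < m" "j < n"
  shows "mat_adjoint (A :: complex mat) $$ (i, j) = cnj (A $$ (j, i))"
  using assms by (simp add: mat_adjoint_def mat_of_rows_index)

lemma agree_sym: "agree_off N S i j = agree_off N S j i"
  by (auto simp: agree_off_def)
lemma agree_refl: "agree_off N S i i"
  by (auto simp: agree_off_def)

lemma bit_sub_index: "bit (sub_index ns i) p \<longleftrightarrow> p < length ns \<and> bit i (ns ! p)"
  by (auto simp: sub_index_def bit_horner_sum_bit_iff)

lemma lt_bits: "(x::nat) < 2 ^ n \<longleftrightarrow> (\<forall>q\<ge>n. \<not> bit x q)"
proof
  assume "x < 2 ^ n"
  hence "take_bit n x = x" by (simp add: take_bit_nat_eq_self)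
  thus "\<forall>q\<ge>n. \<not> bit x q" by (metis bit_take_bit_iff linorder_not_less)
next
  assume "\<forall>q\<ge>n. \<not> bit x q"
  hence "take_bit n x = x" by (intro bit_eqI) (auto simp: bit_take_bit_iff not_le[symmetric])
  thus "x < 2 ^ n" by (metis take_bit_nat_less_exp)
qed

lemma sub_index_less: "sub_index ns i < 2 ^ length ns"
  by (simp add: lt_bits bit_sub_index)

definition from_bits :: "nat \<Rightarrow> (nat \<Rightarrow> bool) \<Rightarrow> nat" where
  "from_bits N f = horner_sum of_bool 2 (map f [0..<N])"

lemma bit_from_bits: "bit (from_bits N f) q \<longleftrightarrow> q < N \<and> f q"
  by (auto simp: from_bits_def bit_horner_sum_bit_iff)

lemma from_bits_less: "from_bits N f < 2 ^ N"
  by (simp add: lt_bits bit_from_bits)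

lemma nat_eqI: "x < 2 ^ N \<Longrightarrow> y < 2 ^ N \<Longrightarrow> (\<And>q. q < N \<Longrightarrow> bit x q = bit (y::nat) q) \<Longrightarrow> x = y"
  by (rule bit_eqI) (metis lt_bits linorder_not_less)

lemma sub_index_eq_iff: "sub_index ns i = sub_index ns j \<longleftrightarrow> (\<forall>q\<in>set ns. bit i q = bit j q)"
proof -
  have "sub_index ns i = sub_index ns j \<longleftrightarrow> (\<forall>p<length ns. bit i (ns ! p) = bit j (ns ! p))"
    unfolding bit_eq_iff bit_sub_index by simp blast
  thus ?thesis by (simp add: all_set_conv_all_nth)
qed

lemma bij_sub_index:
  assumes "distinct ns" "set ns \<subseteq> {..<N}"
  shows "bij_betw (sub_index ns) {k. k < 2 ^ N \<and> agree_off N (set ns) i k} {..<2 ^ length ns}"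
proof (rule bij_betw_imageI)
  show "inj_on (sub_index ns) {k. k < 2 ^ N \<and> agree_off N (set ns) i k}"
    by (rule inj_onI, rule nat_eqI[of _ N]) (auto simp: agree_off_def sub_index_eq_iff)
  have "m \<in> sub_index ns ` {k. k < 2 ^ N \<and> agree_off N (set ns) i k}" if "m < 2 ^ length ns" for m
  proof
    let ?k = "from_bits N (\<lambda>q. if q \<in> set ns then \<exists>p<length ns. ns ! p = q \<and> bit m p else bit i q)"
    show "m = sub_index ns ?k"
      using assms by (intro nat_eqI[OF that sub_index_less])
        (auto simp: bit_sub_index bit_from_bits nth_eq_iff_index_eq
          dest!: subsetD[where c = "ns ! _"])
    show "?k \<in> {k. k < 2 ^ N \<and> agree_off N (set ns) i k}"
      by (auto simp: from_bits_less agree_off_def bit_from_bits)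
  qed
  thus "sub_index ns ` {k. k < 2 ^ N \<and> agree_off N (set ns) i k} = {..<2 ^ length ns}"
    by (auto simp: sub_index_less)
qed

lemma on_qubits_carrier [simp]: "on_qubits N U ns \<in> carrier_mat (2 ^ N) (2 ^ N)"
  by (simp add: on_qubits_def)
lemma on_qubits_dim [simp]: "dim_row (on_qubits N U ns) = 2 ^ N" "dim_col (on_qubits N U ns) = 2 ^ N"
  by (simp_all add: on_qubits_def)

lemma on_qubits_one:
  assumes "set ns \<subseteq> {..<N}"
  shows "on_qubits N (1\<^sub>m (2 ^ length ns)) ns = 1\<^sub>m (2 ^ N)"
proof (rule eq_matI)
  fix i j :: nat assume "i < dim_row (1\<^sub>m (2 ^ N))" "j < dim_col (1\<^sub>m (2 ^ N))"
  hence ij: "i < 2 ^ N" "j < 2 ^ N" by auto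
  have "i = j" if "agree_off N (set ns) i j" "sub_index ns i = sub_index ns j"
    using ij by (rule nat_eqI) (use that in \<open>auto simp: agree_off_def sub_index_eq_iff\<close>)
  thus "on_qubits N (1\<^sub>m (2 ^ length ns)) ns $$ (i, j) = 1\<^sub>m (2 ^ N) $$ (i, j)"
    using ij by (auto simp: on_qubits_def sub_index_less agree_refl)
qed auto

lemma on_qubits_adjoint:
  assumes "U \<in> carrier_mat (2 ^ length ns) (2 ^ length ns)"
  shows "mat_adjoint (on_qubits N U ns) = on_qubits N (mat_adjoint U) ns"
proof (rule eq_matI)
  fix i j :: nat
  assume "i < dim_row (on_qubits N (mat_adjoint U) ns)" "j < dim_col (on_qubits N (mat_adjoint U) ns)"
  hence ij: "i < 2 ^ N" "j < 2 ^ N" by auto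
  show "mat_adjoint (on_qubits N U ns) $$ (i, j) = on_qubits N (mat_adjoint U) ns $$ (i, j)"
    unfolding adjoint_index[OF on_qubits_carrier ij]
    using ij assms agree_sym[of N "set ns" i j]
    by (auto simp: on_qubits_def sub_index_less adjoint_index)
qed (auto simp: mat_adjoint_def)

lemma on_qubits_mult:
  assumes ns: "distinct ns" "set ns \<subseteq> {..<N}"
    and U: "U \<in> carrier_mat (2 ^ length ns) (2 ^ length ns)"
    and V: "V \<in> carrier_mat (2 ^ length ns) (2 ^ length ns)"
  shows "on_qubits N U ns * on_qubits N V ns = on_qubits N (U * V) ns"
proof (rule eq_matI)
  fix i j :: nat
  assume "i < dim_row (on_qubits N (U * V) ns)" "j < dim_col (on_qubits N (U * V) ns)"
  hence ij: "i < 2 ^ N" "j < 2 ^ N" by auto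
  let ?s = "sub_index ns" and ?a = "agree_off N (set ns)"
  have "(on_qubits N U ns * on_qubits N V ns) $$ (i, j)
    = (\<Sum>k<2^N. on_qubits N U ns $$ (i, k) * on_qubits N V ns $$ (k, j))"
    using ij by (simp add: scalar_prod_def lessThan_atLeast0)
  also have "\<dots> = (\<Sum>k<2^N. if ?a i k then (if ?a i j then U $$ (?s i, ?s k) * V $$ (?s k, ?s j) else 0) else 0)"
    using ij by (intro sum.cong) (auto simp: on_qubits_def agree_off_def)
  also have "\<dots> = (\<Sum>k\<in>{k. k < 2^N \<and> ?a i k}. if ?a i j then U $$ (?s i, ?s k) * V $$ (?s k, ?s j) else 0)"
    by (subst sum.inter_filter[symmetric]) (auto intro: sum.cong)
  also have "\<dots> = (\<Sum>m<2^length ns. if ?a i j then U $$ (?s i, m) * V $$ (m, ?s j) else 0)"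
    by (rule sum.reindex_bij_betw[OF bij_sub_index[OF ns]])
  also have "\<dots> = on_qubits N (U * V) ns $$ (i, j)"
    using ij U V sub_index_less[of ns i] sub_index_less[of ns j]
    by (simp add: on_qubits_def scalar_prod_def lessThan_atLeast0)
  finally show "(on_qubits N U ns * on_qubits N V ns) $$ (i, j) = on_qubits N (U * V) ns $$ (i, j)" .
qed auto

lemma on_qubits_mult_disjoint:
  assumes "set ns \<inter> set ms = {}" "i < 2 ^ N" "j < 2 ^ N"
  shows "(on_qubits N U ns * on_qubits N V ms) $$ (i, j) =
    (if agree_off N (set ns \<union> set ms) i j
     then U $$ (sub_index ns i, sub_index ns j) * V $$ (sub_index ms i, sub_index ms j) else 0)"
proof -
  define k0 where "k0 = from_bits N (\<lambda>q. if q \<in> set ns then bit j q else bit i q)"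
  have k0: "bit k0 q \<longleftrightarrow> q < N \<and> (if q \<in> set ns then bit j q else bit i q)" for q
    by (simp add: k0_def bit_from_bits)
  have k0_less: "k0 < 2 ^ N"
    by (simp add: k0_def from_bits_less)
  have eq: "k = k0 \<and> agree_off N (set ns \<union> set ms) i j"
    if "k < 2 ^ N" "agree_off N (set ns) i k" "agree_off N (set ms) k j" for k
  proof
    have ms: "q \<notin> set ms" if "q \<in> set ns" for q
      using assms(1) that by auto
    show "k = k0"
      by (rule nat_eqI[OF that(1) k0_less])
        (use that(2,3) ms in \<open>simp add: k0 agree_off_def\<close>)
    show "agree_off N (set ns \<union> set ms) i j"
      using that(2,3) by (simp add: agree_off_def)
  qed
  have "(on_qubits N U ns * on_qubits N V ms) $$ (i, j)
    = (\<Sum>k<2^N. on_qubits N U ns $$ (i, k) * on_qubits N V ms $$ (k, j))"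
    using assms by (simp add: scalar_prod_def lessThan_atLeast0)
  also have "\<dots> = (\<Sum>k<2^N. if k = k0 then (if agree_off N (set ns \<union> set ms) i j
     then U $$ (sub_index ns i, sub_index ns k) * V $$ (sub_index ms k, sub_index ms j) else 0) else 0)"
  proof (rule sum.cong)
    fix k :: nat assume "k \<in> {..<2^N}"
    hence k: "k < 2 ^ N" by auto
    have "agree_off N (set ns) i k0 \<and> agree_off N (set ms) k0 j" if "agree_off N (set ns \<union> set ms) i j"
      using assms that by (auto simp: k0 agree_off_def)
    hence iff: "agree_off N (set ns) i k \<and> agree_off N (set ms) k j \<longleftrightarrow>
        k = k0 \<and> agree_off N (set ns \<union> set ms) i j"
      using eq[OF k] by blast
    have "on_qubits N U ns $$ (i, k) * on_qubits N V ms $$ (k, j) =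
      (if agree_off N (set ns) i k \<and> agree_off N (set ms) k j
       then U $$ (sub_index ns i, sub_index ns k) * V $$ (sub_index ms k, sub_index ms j) else 0)"
      using k assms(2,3) by (simp add: on_qubits_def)
    thus "on_qubits N U ns $$ (i, k) * on_qubits N V ms $$ (k, j) = (if k = k0 then (if agree_off N (set ns \<union> set ms) i j
     then U $$ (sub_index ns i, sub_index ns k) * V $$ (sub_index ms k, sub_index ms j) else 0) else 0)"
      unfolding iff by simp
  qed simp
  also have "\<dots> = (if agree_off N (set ns \<union> set ms) i j
     then U $$ (sub_index ns i, sub_index ns k0) * V $$ (sub_index ms k0, sub_index ms j) else 0)"
    using k0_less by (subst sum.delta) auto
  also have "\<dots> = (if agree_off N (set ns \<union> set ms) i j
     then U $$ (sub_index ns i, sub_index ns j) * V $$ (sub_index ms i, sub_index ms j) else 0)"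
  proof -
    have lt: "q < N" if "bit i q \<or> bit j q" for q
      using that assms(2,3) unfolding lt_bits by (meson not_le)
    have "sub_index ns k0 = sub_index ns j"
      unfolding sub_index_eq_iff k0 using lt by auto
    moreover have "sub_index ms k0 = sub_index ms i"
      unfolding sub_index_eq_iff k0 using lt assms(1) by auto
    ultimately
    show ?thesis by simp
  qed
  finally show ?thesis .
qed

lemma on_qubits_commute:
  assumes "set ns \<inter> set ms = {}"
  shows "on_qubits N U ns * on_qubits N V ms = on_qubits N V ms * on_qubits N U ns"
proof (rule eq_matI)
  fix i j :: nat
  assume "i < dim_row (on_qubits N V ms * on_qubits N U ns)" "j < dim_col (on_qubits N V ms * on_qubits N U ns)"
  hence ij: "i < 2 ^ N" "j < 2 ^ N" by auto
  have d: "set ms \<inter> set ns = {}" using assms by auto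
  show "(on_qubits N U ns * on_qubits N V ms) $$ (i, j) = (on_qubits N V ms * on_qubits N U ns) $$ (i, j)"
    unfolding on_qubits_mult_disjoint[OF assms ij] on_qubits_mult_disjoint[OF d ij]
    by (simp add: Un_commute mult.commute)
qed auto

primrec label_qubits :: "label \<Rightarrow> nat set" where
  "label_qubits LSkip = {}"
| "label_qubits (LGate U ns) = set ns"
| "label_qubits (LProj b n) = {n}"

lemma label_op_carrier [simp]: "label_op N l \<in> carrier_mat (2 ^ N) (2 ^ N)"
  by (cases l) auto

lemma label_op_commute:
  assumes "label_qubits l \<inter> label_qubits l' = {}"
  shows "label_op N l * label_op N l' = label_op N l' * label_op N l"
proof -
  have [simp]: "1\<^sub>m (2 ^ N) * on_qubits N U ns = on_qubits N U ns"
      "on_qubits N U ns * 1\<^sub>m (2 ^ N) = on_qubits N U ns" for U ns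
    by (rule left_mult_one_mat[OF on_qubits_carrier], rule right_mult_one_mat[OF on_qubits_carrier])
  show ?thesis using assms by (cases l; cases l') (auto intro!: on_qubits_commute)
qed

lemma unitary_on_qubits:
  assumes "distinct ns" "set ns \<subseteq> {..<N}" "unitary_mat (2 ^ length ns) U"
  shows "unitary_mat (2 ^ N) (on_qubits N U ns)"
proof -
  have U: "U \<in> carrier_mat (2 ^ length ns) (2 ^ length ns)"
    and UU: "mat_adjoint U * U = 1\<^sub>m (2 ^ length ns)" "U * mat_adjoint U = 1\<^sub>m (2 ^ length ns)"
    using assms(3) by (auto simp: unitary_mat_def)
  have A: "mat_adjoint U \<in> carrier_mat (2 ^ length ns) (2 ^ length ns)"
    using U by (auto simp: mat_adjoint_def)
  show ?thesis
    using assms by (simp add: unitary_mat_def on_qubits_adjoint[OF U] on_qubits_mult[OF assms(1,2) U A]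
      on_qubits_mult[OF assms(1,2) A U] UU on_qubits_one)
qed

lemma unitary_one: "unitary_mat d (1\<^sub>m d)"
proof -
  have "mat_adjoint (1\<^sub>m d) = (1\<^sub>m d :: complex mat)"
  proof (rule eq_matI)
    fix i j assume "i < dim_row (1\<^sub>m d :: complex mat)" "j < dim_col (1\<^sub>m d :: complex mat)"
    hence "i < d" "j < d" by auto
    thus "mat_adjoint (1\<^sub>m d) $$ (i, j) = (1\<^sub>m d :: complex mat) $$ (i, j)"
      unfolding adjoint_index[OF one_carrier_mat \<open>i < d\<close> \<open>j < d\<close>] by auto
  qed (auto simp: mat_adjoint_def)
  thus ?thesis by (simp add: unitary_mat_def)
qed

lemma projection_ket_bra:
  assumes "n < N"
  shows "projection_mat (2 ^ N) (on_qubits N (ket_bra b) [n])"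
proof -
  have K: "ket_bra b \<in> carrier_mat (2 ^ length [n]) (2 ^ length [n])" by (simp add: ket_bra_def)
  have K2: "ket_bra b \<in> carrier_mat 2 2" by (simp add: ket_bra_def)
  have "ket_bra b * ket_bra b = ket_bra b"
  proof (rule eq_matI)
    fix i j assume "i < dim_row (ket_bra b)" "j < dim_col (ket_bra b)"
    hence ij: "i < 2" "j < 2" by (auto simp: ket_bra_def)
    have "{0..<2} = {0, 1 :: nat}" by auto
    with ij show "(ket_bra b * ket_bra b) $$ (i, j) = ket_bra b $$ (i, j)"
      by (cases b) (auto simp: ket_bra_def scalar_prod_def dest!: less_2_cases)
  qed (auto simp: ket_bra_def)
  moreover have "mat_adjoint (ket_bra b) = ket_bra b"
  proof (rule eq_matI)
    fix i j assume "i < dim_row (ket_bra b)" "j < dim_col (ket_bra b)"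
    hence "i < 2" "j < 2" by (auto simp: ket_bra_def)
    thus "mat_adjoint (ket_bra b) $$ (i, j) = ket_bra b $$ (i, j)"
      unfolding adjoint_index[OF K2 \<open>i < 2\<close> \<open>j < 2\<close>] by (auto simp: ket_bra_def)
  qed (auto simp: mat_adjoint_def ket_bra_def)
  ultimately show ?thesis
    using assms by (simp add: projection_mat_def on_qubits_mult[OF _ _ K K] on_qubits_adjoint[OF K])
qed

lemma on_qubits_ket_bra_sum:
  assumes "n < N"
  shows "mat (2^N) (2^N) (\<lambda>ij. on_qubits N (ket_bra b) [n] $$ ij + on_qubits N (ket_bra (\<not> b)) [n] $$ ij)
    = 1\<^sub>m (2 ^ N)"
proof (rule eq_matI)
  fix i j :: nat assume "i < dim_row (1\<^sub>m (2 ^ N))" "j < dim_col (1\<^sub>m (2 ^ N))"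
  hence ij: "i < 2 ^ N" "j < 2 ^ N" by auto
  have sub: "sub_index [n] k = of_bool (bit k n)" for k
    by (simp add: sub_index_def)
  have "i = j" if "agree_off N {n} i j" "bit i n = bit j n"
    using ij by (rule nat_eqI) (use that in \<open>auto simp: agree_off_def\<close>)
  thus "mat (2^N) (2^N) (\<lambda>ij. on_qubits N (ket_bra b) [n] $$ ij + on_qubits N (ket_bra (\<not> b)) [n] $$ ij) $$ (i, j) = 1\<^sub>m (2 ^ N) $$ (i, j)"
    using ij by (cases "i = j"; cases "bit i n"; cases "bit j n"; cases b)
      (auto simp: on_qubits_def sub ket_bra_def agree_refl)
qed auto

lemma event_structureD:
  assumes "event_structure E"
  shows "causality E \<subseteq> events E \<times> events E"
    and "e \<in> events E \<Longrightarrow> (e, e) \<in> causality E"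
    and "(c, d) \<in> causality E \<Longrightarrow> (d, e) \<in> causality E \<Longrightarrow> (c, e) \<in> causality E"
    and "(d, e) \<in> causality E \<Longrightarrow> (e, d) \<in> causality E \<Longrightarrow> d = e"
    and "conflict E \<subseteq> events E \<times> events E"
    and "(e, e) \<notin> conflict E"
    and "(d, e) \<in> conflict E \<Longrightarrow> (e, d) \<in> conflict E"
    and "(c, d) \<in> conflict E \<Longrightarrow> (d, e) \<in> causality E \<Longrightarrow> (c, e) \<in> conflict E"
  using assms unfolding event_structure_def partial_order_on_def preorder_on_def
  by (auto dest: refl_onD transD antisymD symD irreflD)

lemma event_structureI:
  assumes "finite (events E)"
    and "causality E \<subseteq> events E \<times> events E"
    and "\<And>e. e \<in> events E \<Longrightarrow> (e, e) \<in> causality E"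
    and "\<And>c d e. (c, d) \<in> causality E \<Longrightarrow> (d, e) \<in> causality E \<Longrightarrow> (c, e) \<in> causality E"
    and "\<And>d e. (d, e) \<in> causality E \<Longrightarrow> (e, d) \<in> causality E \<Longrightarrow> d = e"
    and "conflict E \<subseteq> events E \<times> events E"
    and "\<And>e. (e, e) \<notin> conflict E"
    and "\<And>d e. (d, e) \<in> conflict E \<Longrightarrow> (e, d) \<in> conflict E"
    and "\<And>c d e. (c, d) \<in> conflict E \<Longrightarrow> (d, e) \<in> causality E \<Longrightarrow> (c, e) \<in> conflict E"
  shows "event_structure E"
proof -
  have "finite {d. (d, e) \<in> causality E}" for e
    by (rule finite_subset[OF _ assms(1)]) (use assms(2) in auto)
  moreover have "refl_on (events E) (causality E)" using assms(3) by (auto simp: refl_on_def)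
  moreover have "trans (causality E)" using assms(4) by (auto intro: transI)
  moreover have "antisym (causality E)" using assms(5) by (auto intro: antisymI)
  moreover have "irrefl (conflict E)" using assms(7) by (auto simp: irrefl_def)
  moreover have "sym (conflict E)" using assms(8) by (auto intro: symI)
  ultimately show ?thesis
    using assms(2,6,9) unfolding event_structure_def partial_order_on_def preorder_on_def by blast
qed

lemma maximal_configurationD:
  assumes "maximal_configuration E x"
  shows "x \<subseteq> events E"
    and "e \<in> x \<Longrightarrow> (d, e) \<in> causality E \<Longrightarrow> d \<in> x"
    and "d \<in> x \<Longrightarrow> e \<in> x \<Longrightarrow> (d, e) \<notin> conflict E"
  using assms unfolding maximal_configuration_def configuration_def by auto

lemma maximal_configuration_conflict:
  assumes E: "event_structure E" and x: "maximal_configuration E x" and e: "e \<in> events E" "e \<notin> x"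
  shows "\<exists>a\<in>x. (e, a) \<in> conflict E"
proof (rule ccontr)
  assume n: "\<not> ?thesis"
  note ES = event_structureD[OF E] and mx = maximal_configurationD[OF x]
  let ?y = "x \<union> {d. (d, e) \<in> causality E}"
  have 1: "(a, d) \<notin> conflict E" if "a \<in> x" "(d, e) \<in> causality E" for a d
    using n that ES(7,8) by blast
  have 2: "(c, d) \<notin> conflict E" if "(c, e) \<in> causality E" "(d, e) \<in> causality E" for c d
    using that ES(6,7,8) by blast
  have "configuration E ?y"
    unfolding configuration_def
  proof (intro conjI ballI allI impI)
    show "?y \<subseteq> events E" using mx(1) ES(1) by blast
    show "c \<in> ?y" if "d \<in> ?y \<and> (c, d) \<in> causality E" for c d
    proof (cases "d \<in> x")
      case True
      thus ?thesis using that mx(2) by blast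
    next
      case False
      hence "(c, e) \<in> causality E" using that ES(3)[of c d e] by simp
      thus ?thesis by simp
    qed
    show "(c, d) \<notin> conflict E" if cd: "c \<in> ?y" "d \<in> ?y" for c d
    proof -
      consider "c \<in> x" "d \<in> x" | "c \<in> x" "(d, e) \<in> causality E" | "(c, e) \<in> causality E" "d \<in> x"
        | "(c, e) \<in> causality E" "(d, e) \<in> causality E" using cd by auto
      thus ?thesis
      proof cases
        case 3
        thus ?thesis using 1[of d c] ES(7)[of c d] by auto
      qed (use mx(3) 1 2 in auto)
    qed
  qed
  hence "?y = x" using x unfolding maximal_configuration_def by blast
  moreover have "e \<in> ?y" using ES(2)[OF e(1)] by simp
  ultimately show False using e(2) by blast
qed

lemma minimal_conflictD:
  assumes "minimal_conflict E d e"
  shows "(d, e) \<in> conflict E"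
    and "(d', d) \<in> causality E \<Longrightarrow> (e', e) \<in> causality E \<Longrightarrow> (d', e') \<in> conflict E \<Longrightarrow> d' = d \<and> e' = e"
  using assms unfolding minimal_conflict_def by auto

lemma event_structure_single: "event_structure (single_ues e A)"
  by (rule event_structureI) (auto simp: single_ues_def)

lemma ues_single:
  assumes "unitary_mat (2 ^ N) A"
  shows "unitary_event_structure N (single_ues e A)"
proof -
  have m: "\<not> minimal_conflict (single_ues e A) c d" for c d
    by (auto simp: minimal_conflict_def single_ues_def)
  have "mat_sum (2 ^ N) (\<lambda>_. A) {e} = A"
    using assms by (auto simp: mat_sum_def unitary_mat_def intro!: eq_matI)
  thus ?thesis
    using assms event_structure_single m
    by (auto simp: unitary_event_structure_def conflict_class_def concurrent_def)
      (auto simp: single_ues_def)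
qed

lemma seq_simps:
  "Fst e \<in> events (seq_ues A B) \<longleftrightarrow> e \<in> events A"
  "After e x \<in> events (seq_ues A B) \<longleftrightarrow> e \<in> events B \<and> maximal_configuration A (fset x)"
  "(Fst d, Fst e) \<in> causality (seq_ues A B) \<longleftrightarrow> (d, e) \<in> causality A"
  "(Fst d, After e x) \<in> causality (seq_ues A B) \<longleftrightarrow>
     d \<in> fset x \<and> e \<in> events B \<and> maximal_configuration A (fset x)"
  "(After e x, Fst d) \<notin> causality (seq_ues A B)"
  "(After d x, After e y) \<in> causality (seq_ues A B) \<longleftrightarrow>
     x = y \<and> (d, e) \<in> causality B \<and> maximal_configuration A (fset x)"
  "(Fst d, Fst e) \<in> conflict (seq_ues A B) \<longleftrightarrow> (d, e) \<in> conflict A"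
  "(Fst d, After e x) \<in> conflict (seq_ues A B) \<longleftrightarrow>
     e \<in> events B \<and> maximal_configuration A (fset x) \<and> (\<exists>a\<in>fset x. (d, a) \<in> conflict A)"
  "(After e x, Fst d) \<in> conflict (seq_ues A B) \<longleftrightarrow>
     e \<in> events B \<and> maximal_configuration A (fset x) \<and> (\<exists>a\<in>fset x. (a, d) \<in> conflict A)"
  "op (seq_ues A B) (Fst d) = op A d"
  "op (seq_ues A B) (After d x) = op B d"
  by (auto simp: seq_ues_def)

lemma seq_conflict_After:
  "(After d x, After e y) \<in> conflict (seq_ues A B) \<longleftrightarrow>
     x = y \<and> (d, e) \<in> conflict B \<and> maximal_configuration A (fset x)
     \<or> d \<in> events B \<and> e \<in> events B \<and> maximal_configuration A (fset x)
       \<and> maximal_configuration A (fset y) \<and> (\<exists>a\<in>fset x. \<exists>b\<in>fset y. (a, b) \<in> conflict A)"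
  by (auto simp: seq_ues_def)

lemma seq_shape:
  "(d, e) \<in> causality (seq_ues A B) \<Longrightarrow> d \<in> range Fst \<union> range (case_prod After) \<and> e \<in> range Fst \<union> range (case_prod After)"
  "(d, e) \<in> conflict (seq_ues A B) \<Longrightarrow> d \<in> range Fst \<union> range (case_prod After) \<and> e \<in> range Fst \<union> range (case_prod After)"
  "e \<in> events (seq_ues A B) \<Longrightarrow> e \<in> range Fst \<union> range (case_prod After)"
  by (auto simp: seq_ues_def)

lemma seq_eventE:
  assumes "e \<in> events (seq_ues A B)"
  obtains (F) e' where "e = Fst e'" "e' \<in> events A"
  | (A) e' x where "e = After e' x" "e' \<in> events B" "maximal_configuration A (fset x)"
  using assms by (auto simp: seq_ues_def)

lemma seq_causalityE:
  assumes "(d, e) \<in> causality (seq_ues A B)"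
  obtains (FF) d' e' where "d = Fst d'" "e = Fst e'" "(d', e') \<in> causality A"
  | (FA) d' e' x where "d = Fst d'" "e = After e' x" "d' \<in> fset x" "e' \<in> events B"
      "maximal_configuration A (fset x)"
  | (AA) d' e' x where "d = After d' x" "e = After e' x" "(d', e') \<in> causality B"
      "maximal_configuration A (fset x)"
  using assms by (auto simp: seq_ues_def)

lemma seq_conflictE:
  assumes "(d, e) \<in> conflict (seq_ues A B)"
  obtains (FF) d' e' where "d = Fst d'" "e = Fst e'" "(d', e') \<in> conflict A"
  | (FA) d' e' x a where "d = Fst d'" "e = After e' x" "e' \<in> events B"
      "maximal_configuration A (fset x)" "a \<in> fset x" "(d', a) \<in> conflict A"
  | (AF) d' e' x a where "d = After d' x" "e = Fst e'" "d' \<in> events B"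
      "maximal_configuration A (fset x)" "a \<in> fset x" "(a, e') \<in> conflict A"
  | (AA) d' e' x where "d = After d' x" "e = After e' x" "(d', e') \<in> conflict B"
      "maximal_configuration A (fset x)"
  | (AA') d' e' x y a b where "d = After d' x" "e = After e' y" "d' \<in> events B" "e' \<in> events B"
      "maximal_configuration A (fset x)" "maximal_configuration A (fset y)"
      "a \<in> fset x" "b \<in> fset y" "(a, b) \<in> conflict A"
  using assms unfolding seq_ues_def by auto

lemma finite_events_seq:
  assumes "finite (events A)" "finite (events B)"
  shows "finite (events (seq_ues A B))"
proof -
  have "inj fset" by (simp add: fset_inject inj_on_def)
  hence "finite {x. fset x \<in> Pow (events A)}"
    using finite_vimageI[of "Pow (events A)" fset] assms(1) by (simp add: vimage_def)
  moreover have "{x. maximal_configuration A (fset x)} \<subseteq> {x. fset x \<in> Pow (events A)}"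
    using maximal_configurationD(1) by auto
  ultimately have "finite {x. maximal_configuration A (fset x)}" using finite_subset by blast
  moreover have "events (seq_ues A B) = Fst ` events A \<union>
      (\<lambda>(e, x). After e x) ` (events B \<times> {x. maximal_configuration A (fset x)})"
    by (auto simp: seq_ues_def)
  ultimately show ?thesis using assms by simp
qed

lemma event_structure_seq:
  assumes A: "event_structure A" "finite (events A)" and B: "event_structure B" "finite (events B)"
  shows "event_structure (seq_ues A B)"
proof (rule event_structureI)
  note EA = event_structureD[OF A(1)] and EB = event_structureD[OF B(1)]
  note mx = maximal_configurationD[of A]
  note ss = seq_simps seq_conflict_After
  show "finite (events (seq_ues A B))" using A B by (simp add: finite_events_seq)
  show "causality (seq_ues A B) \<subseteq> events (seq_ues A B) \<times> events (seq_ues A B)"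
    using EA(1) EB(1) mx(1) by (fastforce elim!: seq_causalityE simp: ss)
  show "conflict (seq_ues A B) \<subseteq> events (seq_ues A B) \<times> events (seq_ues A B)"
    using EA(5) EB(5) by (auto elim!: seq_conflictE simp: ss)
  fix c d e
  show "(e, e) \<in> causality (seq_ues A B)" if "e \<in> events (seq_ues A B)"
    using seq_shape(3)[OF that] that EA(2) EB(2) by (auto simp: ss)
  show "(e, e) \<notin> conflict (seq_ues A B)"
  proof
    assume "(e, e) \<in> conflict (seq_ues A B)"
    thus False
    proof (cases rule: seq_conflictE)
      case (AA' d' e' x y a b)
      thus False using mx(3)[of "fset x" a b] by simp
    qed (use EA(6) EB(6) in auto)
  qed
  show "d = e" if "(d, e) \<in> causality (seq_ues A B)" "(e, d) \<in> causality (seq_ues A B)"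
    using that(1)
  proof (cases rule: seq_causalityE)
    case (FF d' e')
    thus ?thesis using that(2) EA(4)[of d' e'] by (simp add: ss)
  next
    case (FA d' e' x)
    thus ?thesis using that(2) by (simp add: ss)
  next
    case (AA d' e' x)
    thus ?thesis using that(2) EB(4)[of d' e'] by (simp add: ss)
  qed
  show "(e, d) \<in> conflict (seq_ues A B)" if "(d, e) \<in> conflict (seq_ues A B)"
    using that
  proof (cases rule: seq_conflictE)
    case (FF d' e')
    thus ?thesis using EA(7)[of d' e'] by (simp add: ss)
  next
    case (FA d' e' x a)
    thus ?thesis using EA(7)[of d' a] by (auto simp: ss)
  next
    case (AF d' e' x a)
    thus ?thesis using EA(7)[of a e'] by (auto simp: ss)
  next
    case (AA d' e' x)
    thus ?thesis using EB(7)[of d' e'] by (auto simp: ss)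
  next
    case (AA' d' e' x y a b)
    thus ?thesis using EA(7)[of a b] by (auto simp: ss)
  qed
  show "(c, e) \<in> causality (seq_ues A B)"
    if "(c, d) \<in> causality (seq_ues A B)" "(d, e) \<in> causality (seq_ues A B)"
    using that(1)
  proof (cases rule: seq_causalityE)
    case (FF c' d')
    from that(2) show ?thesis
    proof (cases rule: seq_causalityE)
      case (FF d'' e')
      thus ?thesis using \<open>c = Fst c'\<close> \<open>d = Fst d'\<close> \<open>(c', d') \<in> causality A\<close> EA(3)[of c' d' e'] by (simp add: ss)
    next
      case (FA d'' e' x)
      thus ?thesis using \<open>c = Fst c'\<close> \<open>d = Fst d'\<close> \<open>(c', d') \<in> causality A\<close> mx(2)[of "fset x" d' c']
        by (simp add: ss)
    qed (use FF in auto)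
  next
    case (FA c' d' x)
    from that(2) show ?thesis
      using FA EB(1) by (cases rule: seq_causalityE) (auto simp: ss)
  next
    case (AA c' d' x)
    from that(2) show ?thesis
      using AA EB(3)[of c' d'] by (cases rule: seq_causalityE) (auto simp: ss)
  qed
  show "(c, e) \<in> conflict (seq_ues A B)"
    if "(c, d) \<in> conflict (seq_ues A B)" "(d, e) \<in> causality (seq_ues A B)"
    using that(2)
  proof (cases rule: seq_causalityE)
    case (FF d' e')
    note h = this
    from that(1) show ?thesis
    proof (cases rule: seq_conflictE)
      case (FF c' d'')
      thus ?thesis using h EA(8)[of c' d' e'] by (simp add: ss)
    next
      case (AF c' d'' x a)
      thus ?thesis using h EA(8)[of a d' e'] by (auto simp: ss)
    qed (use h in auto)
  next
    case (FA d' e' x)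
    note h = this
    from that(1) show ?thesis
    proof (cases rule: seq_conflictE)
      case (FF c' d'')
      thus ?thesis using h by (auto simp: ss)
    next
      case (AF c' d'' y a)
      thus ?thesis using h by (auto simp: ss)
    qed (use h in auto)
  next
    case (AA d' e' x)
    note h = this
    have e': "e' \<in> events B" using AA EB(1) by auto
    from that(1) show ?thesis
    proof (cases rule: seq_conflictE)
      case (FA c' d'' y a)
      thus ?thesis using h e' by (auto simp: ss)
    next
      case (AA c' d'' y)
      thus ?thesis using h EB(8)[of c' d' e'] by (auto simp: ss)
    next
      case (AA' c' d'' y z a b)
      thus ?thesis using h e' by (auto simp: ss)
    qed (use h in auto)
  qed
qed

lemma mat_sum_image: "inj f \<Longrightarrow> mat_sum d g (f ` X) = mat_sum d (g \<circ> f) X"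
  by (simp add: mat_sum_def sum.reindex[OF inj_on_subset])

lemma uesD:
  assumes "unitary_event_structure N E"
  shows "event_structure E"
    and "e \<in> events E \<Longrightarrow> unitary_mat (2 ^ N) (op E e) \<or> projection_mat (2 ^ N) (op E e)"
    and "concurrent E d e \<Longrightarrow> op E d * op E e = op E e * op E d"
    and "minimal_conflict E c d \<Longrightarrow> minimal_conflict E d e \<Longrightarrow> c \<noteq> e \<Longrightarrow> minimal_conflict E c e"
    and "e \<in> events E \<Longrightarrow> finite (conflict_class E e)"
    and "e \<in> events E \<Longrightarrow> unitary_mat (2 ^ N) (mat_sum (2 ^ N) (op E) (conflict_class E e))"
  using assms unfolding unitary_event_structure_def by blast+

lemma ues_seq:
  assumes A: "unitary_event_structure N A" "finite (events A)"
    and B: "unitary_event_structure N B" "finite (events B)"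
  shows "unitary_event_structure N (seq_ues A B)"
proof -
  let ?S = "seq_ues A B"
  note UA = uesD[OF A(1)] and UB = uesD[OF B(1)]
  note EA = event_structureD[OF UA(1)] and EB = event_structureD[OF UB(1)]
  note mx = maximal_configurationD[of A]
  note ss = seq_simps seq_conflict_After
  have S: "event_structure ?S" using A B UA(1) UB(1) by (simp add: event_structure_seq)
  have mFF: "minimal_conflict ?S (Fst d) (Fst e) \<longleftrightarrow> minimal_conflict A d e" for d e
  proof
    assume "minimal_conflict ?S (Fst d) (Fst e)"
    thus "minimal_conflict A d e" unfolding minimal_conflict_def by (metis event.inject(3) ss(3,7))
  next
    assume m: "minimal_conflict A d e"
    show "minimal_conflict ?S (Fst d) (Fst e)" unfolding minimal_conflict_def
    proof (intro conjI allI impI)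
      show "(Fst d, Fst e) \<in> conflict ?S" using m by (simp add: minimal_conflict_def ss)
    next
      fix d' e' assume *: "(d', Fst d) \<in> causality ?S \<and> (e', Fst e) \<in> causality ?S \<and> (d', e') \<in> conflict ?S"
      hence "d' \<in> range Fst" "e' \<in> range Fst"
        by (auto elim: seq_causalityE)
      thus "d' = Fst d" "e' = Fst e" using * minimal_conflictD(2)[OF m] by (auto simp: ss)
    qed
  qed
  have mFA: "\<not> minimal_conflict ?S (Fst d) (After e x)" "\<not> minimal_conflict ?S (After e x) (Fst d)" for d e x
  proof -
    have *: "\<exists>a. (Fst d, Fst d) \<in> causality ?S \<and> (Fst a, After e x) \<in> causality ?S \<and> (Fst d, Fst a) \<in> conflict ?S"
      if m: "(Fst d, After e x) \<in> conflict ?S"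
    proof -
      obtain a where a: "a \<in> fset x" "(d, a) \<in> conflict A" using m by (auto simp: ss)
      have 1: "(Fst d, Fst d) \<in> causality ?S" using a EA(2,5) by (auto simp: ss)
      have 2: "(Fst a, After e x) \<in> causality ?S" using a m by (auto simp: ss)
      have 3: "(Fst d, Fst a) \<in> conflict ?S" using a by (simp add: ss)
      from 1 2 3 show ?thesis by blast
    qed
    show "\<not> minimal_conflict ?S (Fst d) (After e x)"
      using * unfolding minimal_conflict_def by (metis event.distinct)
    show "\<not> minimal_conflict ?S (After e x) (Fst d)"
    proof
      assume m: "minimal_conflict ?S (After e x) (Fst d)"
      note sym = event_structureD(7)[OF S]
      from *[OF sym[OF minimal_conflictD(1)[OF m]]] obtain a where
        "(Fst d, Fst d) \<in> causality ?S" "(Fst a, After e x) \<in> causality ?S" "(Fst a, Fst d) \<in> conflict ?S"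
        using sym by blast
      thus False using minimal_conflictD(2)[OF m, of "Fst a" "Fst d"] by simp
    qed
  qed
  have mAA: "minimal_conflict ?S (After d x) (After e y) \<longleftrightarrow>
      x = y \<and> maximal_configuration A (fset x) \<and> minimal_conflict B d e" for d e x y
  proof
    assume m: "minimal_conflict ?S (After d x) (After e y)"
    have no: "(a, b) \<notin> conflict A" if "a \<in> fset x" "b \<in> fset y" for a b
    proof
      assume "(a, b) \<in> conflict A"
      hence "(Fst a, After d x) \<in> causality ?S \<and> (Fst b, After e y) \<in> causality ?S \<and> (Fst a, Fst b) \<in> conflict ?S"
        using that subsetD[OF event_structureD(5)[OF S] minimal_conflictD(1)[OF m]] by (auto simp: ss)
      thus False using minimal_conflictD(2)[OF m] by blast
    qed
    hence 1: "x = y" "(d, e) \<in> conflict B" "maximal_configuration A (fset x)"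
      using minimal_conflictD(1)[OF m] by (auto simp: ss)
    moreover have "minimal_conflict B d e"
      unfolding minimal_conflict_def
    proof (intro conjI allI impI 1)
      fix d' e' assume "(d', d) \<in> causality B \<and> (e', e) \<in> causality B \<and> (d', e') \<in> conflict B"
      thus "d' = d" "e' = e"
        using 1 minimal_conflictD(2)[OF m, of "After d' x" "After e' x"] by (auto simp: ss)
    qed
    ultimately show "x = y \<and> maximal_configuration A (fset x) \<and> minimal_conflict B d e" by simp
  next
    assume *: "x = y \<and> maximal_configuration A (fset x) \<and> minimal_conflict B d e"
    hence y: "y = x" and max: "maximal_configuration A (fset x)" and m: "minimal_conflict B d e" by auto
    show "minimal_conflict ?S (After d x) (After e y)" unfolding minimal_conflict_def y
    proof (intro conjI allI impI)
      show "(After d x, After e x) \<in> conflict ?S" using max m by (simp add: minimal_conflict_def ss)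
    next
      fix d' e'
      assume a: "(d', After d x) \<in> causality ?S \<and> (e', After e x) \<in> causality ?S \<and> (d', e') \<in> conflict ?S"
      have cases: "(\<exists>a\<in>fset x. f' = Fst a) \<or> (\<exists>f''. f' = After f'' x \<and> (f'', f) \<in> causality B)"
        if "(f', After f x) \<in> causality ?S" for f f'
        using that by (cases rule: seq_causalityE) auto
      from cases[of d' d] cases[of e' e] a consider
        (FF) b c where "b \<in> fset x" "c \<in> fset x" "d' = Fst b" "e' = Fst c"
        | (FA) b c where "b \<in> fset x" "d' = Fst b" "e' = After c x"
        | (AF) b c where "c \<in> fset x" "d' = After b x" "e' = Fst c"
        | (AA) b c where "d' = After b x" "e' = After c x" "(b, d) \<in> causality B" "(c, e) \<in> causality B"
        by blast
      hence "d' = After d x \<and> e' = After e x"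
      proof cases
        case FF
        thus ?thesis using a mx(3)[OF max, of b c] by (simp add: ss)
      next
        case FA
        thus ?thesis using a mx(3)[OF max, of b] by (auto simp: ss)
      next
        case AF
        thus ?thesis using a mx(3)[OF max, of _ c] by (auto simp: ss)
      next
        case AA
        hence "(b, c) \<in> conflict B" using a mx(3)[OF max] by (auto simp: ss)
        thus ?thesis using AA minimal_conflictD(2)[OF m, of b c] by simp
      qed
      thus "d' = After d x" "e' = After e x" by auto
    qed
  qed
  have mev: "d \<in> events ?S" "e \<in> events ?S" if "minimal_conflict ?S d e" for d e
    using subsetD[OF event_structureD(5)[OF S] minimal_conflictD(1)[OF that]] by auto
  have clF: "conflict_class ?S (Fst e) = Fst ` conflict_class A e" for e
  proof -
    have "minimal_conflict ?S (Fst e) x \<longleftrightarrow> x \<in> Fst ` {d. minimal_conflict A e d}" for x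
    proof
      assume m: "minimal_conflict ?S (Fst e) x"
      from mev(2)[OF m] show "x \<in> Fst ` {d. minimal_conflict A e d}"
        using m by (cases rule: seq_eventE) (auto simp: mFF mFA)
    qed (auto simp: mFF)
    thus ?thesis by (auto simp: conflict_class_def)
  qed
  have clA: "conflict_class ?S (After e x) = (\<lambda>d. After d x) ` conflict_class B e"
    if "maximal_configuration A (fset x)" for e x
  proof -
    have "minimal_conflict ?S (After e x) y \<longleftrightarrow> y \<in> (\<lambda>d. After d x) ` {d. minimal_conflict B e d}" for y
    proof
      assume m: "minimal_conflict ?S (After e x) y"
      from mev(2)[OF m] show "y \<in> (\<lambda>d. After d x) ` {d. minimal_conflict B e d}"
        using m by (cases rule: seq_eventE) (auto simp: mAA mFA)
    qed (use that in \<open>auto simp: mAA\<close>)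
    thus ?thesis by (auto simp: conflict_class_def)
  qed
  have ops: "op ?S \<circ> Fst = op A" "op ?S \<circ> (\<lambda>d. After d x) = op B" for x
    by (auto simp: ss)
  show ?thesis
    unfolding unitary_event_structure_def
  proof (intro conjI S ballI allI impI)
    fix e assume e: "e \<in> events ?S"
    show "unitary_mat (2 ^ N) (op ?S e) \<or> projection_mat (2 ^ N) (op ?S e)"
      using e UA(2) UB(2) by (cases rule: seq_eventE) (simp_all add: ss(10,11))
    show "finite (conflict_class ?S e)"
      using e UA(5) UB(5) by (cases rule: seq_eventE) (simp_all add: clF clA)
    show "unitary_mat (2 ^ N) (mat_sum (2 ^ N) (op ?S) (conflict_class ?S e))"
      using e UA(6) UB(6)
      by (cases rule: seq_eventE) (simp_all add: clF clA mat_sum_image inj_def ops)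
  next
    fix d e assume c: "concurrent ?S d e"
    have AF: "\<not> concurrent ?S (Fst d) (After e x)" "\<not> concurrent ?S (After e x) (Fst d)" for d e x
      using maximal_configuration_conflict[OF UA(1), of "fset x" d] EA(7)
      unfolding concurrent_def by (auto simp: ss)
    have AA: "x = y \<and> concurrent B d e" if "concurrent ?S (After d x) (After e y)" for d e x y
    proof -
      have mxy: "maximal_configuration A (fset x)" "maximal_configuration A (fset y)"
        using that by (auto simp: concurrent_def ss)
      have nc: "\<forall>a\<in>fset x. \<forall>b\<in>fset y. (a, b) \<notin> conflict A"
        using that by (auto simp: concurrent_def ss)
      have "fset x \<subseteq> fset y"
        using maximal_configuration_conflict[OF UA(1) mxy(2)] mx(1)[OF mxy(1)] nc by blast
      moreover have "fset y \<subseteq> fset x"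
        using maximal_configuration_conflict[OF UA(1) mxy(1)] mx(1)[OF mxy(2)] nc EA(7) by blast
      ultimately have "x = y" by (simp add: fset_inject[symmetric])
      thus ?thesis using that by (auto simp: concurrent_def ss)
    qed
    have FF: "concurrent ?S (Fst d) (Fst e) \<Longrightarrow> concurrent A d e" for d e
      by (auto simp: concurrent_def ss)
    have "d \<in> events ?S" "e \<in> events ?S" using c unfolding concurrent_def by blast+
    thus "op ?S d * op ?S e = op ?S e * op ?S d"
    proof (elim seq_eventE)
      fix d' e' assume "d = Fst d'" "e = Fst e'"
      thus ?thesis using UA(3)[OF FF[of d' e']] c by (simp add: ss(10,11))
    next
      fix d' e' x y assume "d = After d' x" "e = After e' y"
      thus ?thesis using UB(3)[OF conjunct2[OF AA[of d' x e' y]]] c by (simp add: ss(10,11))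
    qed (use c AF in auto)
  next
    fix c d e assume m: "minimal_conflict ?S c d \<and> minimal_conflict ?S d e \<and> c \<noteq> e"
    have "c \<in> events ?S" "d \<in> events ?S" "e \<in> events ?S" using m mev by blast+
    thus "minimal_conflict ?S c e"
      using m by (elim seq_eventE) (auto simp: mFF mFA mAA intro: UA(4) UB(4))
  qed
qed

lemma meas_simps:
  "Tau b m \<in> events (meas_ues N n A B) \<longleftrightarrow> m = n"
  "Fst e \<in> events (meas_ues N n A B) \<longleftrightarrow> e \<in> events A"
  "Snd e \<in> events (meas_ues N n A B) \<longleftrightarrow> e \<in> events B"
  "(Tau b m, Tau c k) \<in> causality (meas_ues N n A B) \<longleftrightarrow> m = n \<and> k = n \<and> b = c"
  "(Tau b m, Fst e) \<in> causality (meas_ues N n A B) \<longleftrightarrow> m = n \<and> \<not> b \<and> e \<in> events A"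
  "(Tau b m, Snd e) \<in> causality (meas_ues N n A B) \<longleftrightarrow> m = n \<and> b \<and> e \<in> events B"
  "(Fst d, Tau b m) \<notin> causality (meas_ues N n A B)"
  "(Snd d, Tau b m) \<notin> causality (meas_ues N n A B)"
  "(Fst d, Fst e) \<in> causality (meas_ues N n A B) \<longleftrightarrow> (d, e) \<in> causality A"
  "(Snd d, Snd e) \<in> causality (meas_ues N n A B) \<longleftrightarrow> (d, e) \<in> causality B"
  "(Fst d, Snd e) \<notin> causality (meas_ues N n A B)"
  "(Snd d, Fst e) \<notin> causality (meas_ues N n A B)"
  "(Tau b m, Tau c k) \<in> conflict (meas_ues N n A B) \<longleftrightarrow> m = n \<and> k = n \<and> b \<noteq> c"
  "(Tau b m, Fst e) \<in> conflict (meas_ues N n A B) \<longleftrightarrow> m = n \<and> b \<and> e \<in> events A"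
  "(Tau b m, Snd e) \<in> conflict (meas_ues N n A B) \<longleftrightarrow> m = n \<and> \<not> b \<and> e \<in> events B"
  "(Fst e, Tau b m) \<in> conflict (meas_ues N n A B) \<longleftrightarrow> m = n \<and> b \<and> e \<in> events A"
  "(Snd e, Tau b m) \<in> conflict (meas_ues N n A B) \<longleftrightarrow> m = n \<and> \<not> b \<and> e \<in> events B"
  "(Fst d, Fst e) \<in> conflict (meas_ues N n A B) \<longleftrightarrow> (d, e) \<in> conflict A"
  "(Snd d, Snd e) \<in> conflict (meas_ues N n A B) \<longleftrightarrow> (d, e) \<in> conflict B"
  "(Fst d, Snd e) \<in> conflict (meas_ues N n A B) \<longleftrightarrow> d \<in> events A \<and> e \<in> events B"
  "(Snd e, Fst d) \<in> conflict (meas_ues N n A B) \<longleftrightarrow> d \<in> events A \<and> e \<in> events B"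
  by (auto simp: meas_ues_def)

lemma meas_op_simps:
  "op (meas_ues N n A B) (Tau b m) = label_op N (LProj b m)"
  "op (meas_ues N n A B) (Fst d) = op A d"
  "op (meas_ues N n A B) (Snd d) = op B d"
  by (simp_all add: meas_ues_def Let_def)

lemma meas_eventE:
  assumes "e \<in> events (meas_ues N n A B)"
  obtains (T) b where "e = Tau b n" | (F) e' where "e = Fst e'" "e' \<in> events A"
    | (S) e' where "e = Snd e'" "e' \<in> events B"
  using assms by (auto simp: meas_ues_def)

lemma event_structure_fieldD:
  assumes "event_structure E"
  shows "(d, e) \<in> causality E \<Longrightarrow> d \<in> events E \<and> e \<in> events E"
    and "(d, e) \<in> conflict E \<Longrightarrow> d \<in> events E \<and> e \<in> events E"
  using event_structureD(1,5)[OF assms] by auto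

lemma meas_sub:
  assumes A: "event_structure A" and B: "event_structure B"
  shows "causality (meas_ues N n A B) \<subseteq> events (meas_ues N n A B) \<times> events (meas_ues N n A B)"
      (is "causality ?M \<subseteq> ?E")
    and "conflict (meas_ues N n A B) \<subseteq> events (meas_ues N n A B) \<times> events (meas_ues N n A B)"
proof -
  note fA = event_structure_fieldD[OF A] and fB = event_structure_fieldD[OF B]
  have 1: "{(Fst d, Fst e) | d e. (d, e) \<in> causality A} \<subseteq> ?E"
    "{(Fst d, Fst e) | d e. (d, e) \<in> conflict A} \<subseteq> ?E"
    using fA by (auto simp: meas_simps)
  have 2: "{(Snd d, Snd e) | d e. (d, e) \<in> causality B} \<subseteq> ?E"
    "{(Snd d, Snd e) | d e. (d, e) \<in> conflict B} \<subseteq> ?E"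
    using fB by (auto simp: meas_simps)
  have 3: "insert (Tau False n) (Fst ` events A) \<subseteq> events ?M"
      "insert (Tau True n) (Snd ` events B) \<subseteq> events ?M"
    by (auto simp: meas_simps)
  have 4: "Pair (Tau False n) ` insert (Tau False n) (Fst ` events A) \<subseteq> ?E"
    "Pair (Tau True n) ` insert (Tau True n) (Snd ` events B) \<subseteq> ?E"
    using 3 by auto
  have ca: "causality ?M = Pair (Tau False n) ` insert (Tau False n) (Fst ` events A)
      \<union> {(Fst d, Fst e) | d e. (d, e) \<in> causality A}
      \<union> Pair (Tau True n) ` insert (Tau True n) (Snd ` events B)
      \<union> {(Snd d, Snd e) | d e. (d, e) \<in> causality B}"
    by (simp add: meas_ues_def Let_def)
  show "causality ?M \<subseteq> ?E"
    unfolding ca by (intro Un_least 1 2 4)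
  have 5: "insert (Tau False n) (Fst ` events A) \<times> insert (Tau True n) (Snd ` events B) \<subseteq> ?E"
    "insert (Tau True n) (Snd ` events B) \<times> insert (Tau False n) (Fst ` events A) \<subseteq> ?E"
    using 3 by (meson Sigma_mono)+
  have co: "conflict ?M =
      insert (Tau False n) (Fst ` events A) \<times> insert (Tau True n) (Snd ` events B)
      \<union> insert (Tau True n) (Snd ` events B) \<times> insert (Tau False n) (Fst ` events A)
      \<union> {(Fst d, Fst e) | d e. (d, e) \<in> conflict A}
      \<union> {(Snd d, Snd e) | d e. (d, e) \<in> conflict B}"
    unfolding meas_ues_def Let_def by (simp only: es.simps)
  show "conflict ?M \<subseteq> ?E"
    unfolding co by (intro Un_least 1 2 5)
qed

lemma finite_events_meas:
  "finite (events A) \<Longrightarrow> finite (events B) \<Longrightarrow> finite (events (meas_ues N n A B))"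
  by (simp add: meas_ues_def Let_def)

lemma event_structure_meas:
  assumes A: "event_structure A" "finite (events A)" and B: "event_structure B" "finite (events B)"
  shows "event_structure (meas_ues N n A B)" (is "event_structure ?M")
proof (rule event_structureI)
  note EA = event_structureD[OF A(1)] and EB = event_structureD[OF B(1)]
  note sub = meas_sub[OF A(1) B(1), of N n]
  show "finite (events ?M)" using A B by (simp add: finite_events_meas)
  show "causality ?M \<subseteq> events ?M \<times> events ?M" "conflict ?M \<subseteq> events ?M \<times> events ?M"
    by (fact sub)+
  fix c d e
  show "(e, e) \<in> causality ?M" if "e \<in> events ?M"
    using that by (cases rule: meas_eventE) (auto simp: meas_simps EA(2) EB(2))
  show "(e, e) \<notin> conflict ?M"
    using sub(2) by (cases e) (auto simp: meas_simps EA(6) EB(6) meas_ues_def Let_def)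
  show "d = e" if h: "(d, e) \<in> causality ?M" "(e, d) \<in> causality ?M"
  proof -
    have "d \<in> events ?M" "e \<in> events ?M" using h sub by auto
    thus ?thesis using h EA(4) EB(4)
      by (elim meas_eventE) (simp_all add: meas_simps)
  qed
  show "(e, d) \<in> conflict ?M" if h: "(d, e) \<in> conflict ?M"
  proof -
    have "d \<in> events ?M" "e \<in> events ?M" using h sub by auto
    thus ?thesis using h
      by (elim meas_eventE) (auto simp: meas_simps intro: EA(7) EB(7))
  qed
  show "(c, e) \<in> causality ?M" if h: "(c, d) \<in> causality ?M" "(d, e) \<in> causality ?M"
  proof -
    have "c \<in> events ?M" "d \<in> events ?M" "e \<in> events ?M" using h sub by auto
    thus ?thesis using h
      by (elim meas_eventE) (auto simp: meas_simps intro: EA(3) EB(3))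
  qed
  show "(c, e) \<in> conflict ?M" if h: "(c, d) \<in> conflict ?M" "(d, e) \<in> causality ?M"
  proof -
    have "c \<in> events ?M" "d \<in> events ?M" "e \<in> events ?M" using h sub by auto
    thus ?thesis using h
      by (elim meas_eventE) (auto simp: meas_simps intro: EA(8) EB(8))
  qed
qed

lemma ues_meas:
  assumes n: "n < N"
    and A: "unitary_event_structure N A" "finite (events A)"
    and B: "unitary_event_structure N B" "finite (events B)"
  shows "unitary_event_structure N (meas_ues N n A B)" (is "unitary_event_structure N ?M")
proof -
  note UA = uesD[OF A(1)] and UB = uesD[OF B(1)]
  note EA = event_structureD[OF UA(1)] and EB = event_structureD[OF UB(1)]
  note ss = meas_simps
  have M: "event_structure ?M" using A B UA(1) UB(1) by (simp add: event_structure_meas)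
  note sub = event_structureD(1,5)[OF M]
  have mev: "d \<in> events ?M" "e \<in> events ?M" if "minimal_conflict ?M d e" for d e
    using minimal_conflictD(1)[OF that] sub by auto
  have mT: "minimal_conflict ?M (Tau b n) (Tau c n) \<longleftrightarrow> b \<noteq> c" for b c
  proof
    assume "b \<noteq> c"
    show "minimal_conflict ?M (Tau b n) (Tau c n)" unfolding minimal_conflict_def
    proof (intro conjI allI impI)
      show "(Tau b n, Tau c n) \<in> conflict ?M" using \<open>b \<noteq> c\<close> by (simp add: ss)
      fix d' e' assume h: "(d', Tau b n) \<in> causality ?M \<and> (e', Tau c n) \<in> causality ?M \<and> (d', e') \<in> conflict ?M"
      have "d' \<in> events ?M" "e' \<in> events ?M" using h sub by auto
      thus "d' = Tau b n" "e' = Tau c n" using h by (auto elim!: meas_eventE simp: ss)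
    qed
  qed (auto simp: minimal_conflict_def ss)
  have mTF: "\<not> minimal_conflict ?M (Tau b n) (Fst e)" "\<not> minimal_conflict ?M (Fst e) (Tau b n)"
     "\<not> minimal_conflict ?M (Tau b n) (Snd e')" "\<not> minimal_conflict ?M (Snd e') (Tau b n)" for b e e'
  proof -
    show "\<not> minimal_conflict ?M (Tau b n) (Fst e)"
    proof
      assume m: "minimal_conflict ?M (Tau b n) (Fst e)"
      show False using minimal_conflictD(1)[OF m] minimal_conflictD(2)[OF m, of "Tau b n" "Tau False n"]
        by (auto simp: ss)
    qed
    show "\<not> minimal_conflict ?M (Fst e) (Tau b n)"
    proof
      assume m: "minimal_conflict ?M (Fst e) (Tau b n)"
      show False using minimal_conflictD(1)[OF m] minimal_conflictD(2)[OF m, of "Tau False n" "Tau b n"]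
        by (auto simp: ss)
    qed
    show "\<not> minimal_conflict ?M (Tau b n) (Snd e')"
    proof
      assume m: "minimal_conflict ?M (Tau b n) (Snd e')"
      show False using minimal_conflictD(1)[OF m] minimal_conflictD(2)[OF m, of "Tau b n" "Tau True n"]
        by (auto simp: ss)
    qed
    show "\<not> minimal_conflict ?M (Snd e') (Tau b n)"
    proof
      assume m: "minimal_conflict ?M (Snd e') (Tau b n)"
      show False using minimal_conflictD(1)[OF m] minimal_conflictD(2)[OF m, of "Tau True n" "Tau b n"]
        by (auto simp: ss)
    qed
  qed
  have mFS: "\<not> minimal_conflict ?M (Fst d) (Snd e)" "\<not> minimal_conflict ?M (Snd e) (Fst d)" for d e
  proof -
    show "\<not> minimal_conflict ?M (Fst d) (Snd e)"
    proof
      assume m: "minimal_conflict ?M (Fst d) (Snd e)"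
      show False using minimal_conflictD(1)[OF m] minimal_conflictD(2)[OF m, of "Tau False n" "Tau True n"]
        by (auto simp: ss)
    qed
    show "\<not> minimal_conflict ?M (Snd e) (Fst d)"
    proof
      assume m: "minimal_conflict ?M (Snd e) (Fst d)"
      show False using minimal_conflictD(1)[OF m] minimal_conflictD(2)[OF m, of "Tau True n" "Tau False n"]
        by (auto simp: ss)
    qed
  qed
  have mFF: "minimal_conflict ?M (Fst d) (Fst e) \<longleftrightarrow> minimal_conflict A d e" for d e
  proof
    assume "minimal_conflict ?M (Fst d) (Fst e)"
    thus "minimal_conflict A d e" unfolding minimal_conflict_def by (metis event.inject(3) ss(9,18))
  next
    assume m: "minimal_conflict A d e"
    show "minimal_conflict ?M (Fst d) (Fst e)" unfolding minimal_conflict_def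
    proof (intro conjI allI impI)
      show "(Fst d, Fst e) \<in> conflict ?M" using m by (simp add: minimal_conflict_def ss)
    next
      fix d' e' assume h: "(d', Fst d) \<in> causality ?M \<and> (e', Fst e) \<in> causality ?M \<and> (d', e') \<in> conflict ?M"
      have "d' \<in> events ?M" "e' \<in> events ?M" using h sub by auto
      thus "d' = Fst d" "e' = Fst e" using h minimal_conflictD(2)[OF m] by (auto elim!: meas_eventE simp: ss)
    qed
  qed
  have mSS: "minimal_conflict ?M (Snd d) (Snd e) \<longleftrightarrow> minimal_conflict B d e" for d e
  proof
    assume "minimal_conflict ?M (Snd d) (Snd e)"
    thus "minimal_conflict B d e" unfolding minimal_conflict_def by (metis event.inject(4) ss(10,19))
  next
    assume m: "minimal_conflict B d e"
    show "minimal_conflict ?M (Snd d) (Snd e)" unfolding minimal_conflict_def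
    proof (intro conjI allI impI)
      show "(Snd d, Snd e) \<in> conflict ?M" using m by (simp add: minimal_conflict_def ss)
    next
      fix d' e' assume h: "(d', Snd d) \<in> causality ?M \<and> (e', Snd e) \<in> causality ?M \<and> (d', e') \<in> conflict ?M"
      have "d' \<in> events ?M" "e' \<in> events ?M" using h sub by auto
      thus "d' = Snd d" "e' = Snd e" using h minimal_conflictD(2)[OF m] by (auto elim!: meas_eventE simp: ss)
    qed
  qed
  note mm = mT mTF mFS mFF mSS
  have clT: "conflict_class ?M (Tau b n) = {Tau b n, Tau (\<not> b) n}" for b
  proof -
    have "x = Tau (\<not> b) n" if "minimal_conflict ?M (Tau b n) x" for x
      using mev(2)[OF that] that by (cases rule: meas_eventE) (auto simp: mm)
    thus ?thesis by (auto simp: conflict_class_def mm)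
  qed
  have clF: "conflict_class ?M (Fst e) = Fst ` conflict_class A e" for e
    using mev(2) by (fastforce simp: conflict_class_def mm elim!: meas_eventE)
  have clS: "conflict_class ?M (Snd e) = Snd ` conflict_class B e" for e
    using mev(2) by (fastforce simp: conflict_class_def mm elim!: meas_eventE)
  have ops: "op ?M \<circ> Fst = op A" "op ?M \<circ> Snd = op B"
    by (auto simp: meas_op_simps)
  have sumT: "mat_sum (2 ^ N) (op ?M) {Tau b n, Tau (\<not> b) n} = 1\<^sub>m (2 ^ N)" for b
    using on_qubits_ket_bra_sum[OF n, of b] by (simp add: mat_sum_def meas_op_simps)
  show ?thesis
    unfolding unitary_event_structure_def
  proof (intro conjI M ballI allI impI)
    fix e assume e: "e \<in> events ?M"
    show "unitary_mat (2 ^ N) (op ?M e) \<or> projection_mat (2 ^ N) (op ?M e)"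
      using e UA(2) UB(2) projection_ket_bra[OF n] by (cases rule: meas_eventE) (auto simp: meas_op_simps)
    show "finite (conflict_class ?M e)"
      using e UA(5) UB(5) by (cases rule: meas_eventE) (auto simp: clT clF clS)
    show "unitary_mat (2 ^ N) (mat_sum (2 ^ N) (op ?M) (conflict_class ?M e))"
      using e UA(6) UB(6)
      by (cases rule: meas_eventE) (auto simp: clT clF clS sumT unitary_one mat_sum_image inj_def ops)
  next
    fix d e assume c: "concurrent ?M d e"
    hence "d \<in> events ?M" "e \<in> events ?M" by (auto simp: concurrent_def)
    moreover have FF: "concurrent ?M (Fst d) (Fst e) \<Longrightarrow> concurrent A d e"
      and SS: "concurrent ?M (Snd d) (Snd e) \<Longrightarrow> concurrent B d e" for d e
      by (auto simp: concurrent_def ss)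
    moreover have "\<not> concurrent ?M (Tau b n) d" "\<not> concurrent ?M d (Tau b n)" for b d
      unfolding concurrent_def by (auto elim!: meas_eventE simp: ss)
    moreover have "\<not> concurrent ?M (Fst d) (Snd e)" "\<not> concurrent ?M (Snd d) (Fst e)" for d e
      unfolding concurrent_def by (auto simp: ss)
    ultimately show "op ?M d * op ?M e = op ?M e * op ?M d"
      using c UA(3) UB(3) by (elim meas_eventE) (auto simp: meas_op_simps(2,3))
  next
    fix c d e assume m: "minimal_conflict ?M c d \<and> minimal_conflict ?M d e \<and> c \<noteq> e"
    have "c \<in> events ?M" "d \<in> events ?M" "e \<in> events ?M" using m mev by blast+
    thus "minimal_conflict ?M c e"
      using m UA(4) UB(4) by (elim meas_eventE) (auto simp: mm)
  qed
qed

lemma par_simps: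
  "Fst e \<in> events (par_ues A B) \<longleftrightarrow> e \<in> events A"
  "Snd e \<in> events (par_ues A B) \<longleftrightarrow> e \<in> events B"
  "(Fst d, Fst e) \<in> causality (par_ues A B) \<longleftrightarrow> (d, e) \<in> causality A"
  "(Snd d, Snd e) \<in> causality (par_ues A B) \<longleftrightarrow> (d, e) \<in> causality B"
  "(Fst d, Snd e) \<notin> causality (par_ues A B)"
  "(Snd d, Fst e) \<notin> causality (par_ues A B)"
  "(Fst d, Fst e) \<in> conflict (par_ues A B) \<longleftrightarrow> (d, e) \<in> conflict A"
  "(Snd d, Snd e) \<in> conflict (par_ues A B) \<longleftrightarrow> (d, e) \<in> conflict B"
  "(Fst d, Snd e) \<notin> conflict (par_ues A B)"
  "(Snd d, Fst e) \<notin> conflict (par_ues A B)"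
  by (auto simp: par_ues_def)

lemma par_op_simps:
  "op (par_ues A B) (Fst d) = op A d"
  "op (par_ues A B) (Snd d) = op B d"
  by (simp_all add: par_ues_def)

lemma par_eventE:
  assumes "e \<in> events (par_ues A B)"
  obtains (F) e' where "e = Fst e'" "e' \<in> events A" | (S) e' where "e = Snd e'" "e' \<in> events B"
  using assms by (auto simp: par_ues_def)

lemma par_sub:
  assumes A: "event_structure A" and B: "event_structure B"
  shows "causality (par_ues A B) \<subseteq> events (par_ues A B) \<times> events (par_ues A B)"
    and "conflict (par_ues A B) \<subseteq> events (par_ues A B) \<times> events (par_ues A B)"
  using event_structure_fieldD[OF A] event_structure_fieldD[OF B] by (auto simp: par_ues_def)

lemma finite_events_par:
  "finite (events A) \<Longrightarrow> finite (events B) \<Longrightarrow> finite (events (par_ues A B))"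
  by (simp add: par_ues_def)

lemma event_structure_par:
  assumes A: "event_structure A" "finite (events A)" and B: "event_structure B" "finite (events B)"
  shows "event_structure (par_ues A B)" (is "event_structure ?M")
proof (rule event_structureI)
  note EA = event_structureD[OF A(1)] and EB = event_structureD[OF B(1)]
  note sub = par_sub[OF A(1) B(1)]
  show "finite (events ?M)" using A B by (simp add: finite_events_par)
  show "causality ?M \<subseteq> events ?M \<times> events ?M" "conflict ?M \<subseteq> events ?M \<times> events ?M"
    by (fact sub)+
  fix c d e
  show "(e, e) \<in> causality ?M" if "e \<in> events ?M"
    using that by (cases rule: par_eventE) (auto simp: par_simps EA(2) EB(2))
  show "(e, e) \<notin> conflict ?M"
    by (cases e) (auto simp: EA(6) EB(6) par_ues_def)
  show "d = e" if h: "(d, e) \<in> causality ?M" "(e, d) \<in> causality ?M"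
  proof -
    have "d \<in> events ?M" "e \<in> events ?M" using h sub by auto
    thus ?thesis using h EA(4) EB(4)
      by (elim par_eventE) (simp_all add: par_simps)
  qed
  show "(e, d) \<in> conflict ?M" if h: "(d, e) \<in> conflict ?M"
  proof -
    have "d \<in> events ?M" "e \<in> events ?M" using h sub by auto
    thus ?thesis using h
      by (elim par_eventE) (auto simp: par_simps intro: EA(7) EB(7))
  qed
  show "(c, e) \<in> causality ?M" if h: "(c, d) \<in> causality ?M" "(d, e) \<in> causality ?M"
  proof -
    have "c \<in> events ?M" "d \<in> events ?M" "e \<in> events ?M" using h sub by auto
    thus ?thesis using h
      by (elim par_eventE) (auto simp: par_simps intro: EA(3) EB(3))
  qed
  show "(c, e) \<in> conflict ?M" if h: "(c, d) \<in> conflict ?M" "(d, e) \<in> causality ?M"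
  proof -
    have "c \<in> events ?M" "d \<in> events ?M" "e \<in> events ?M" using h sub by auto
    thus ?thesis using h
      by (elim par_eventE) (auto simp: par_simps intro: EA(8) EB(8))
  qed
qed

lemma ues_par:
  assumes A: "unitary_event_structure N A" "finite (events A)"
    and B: "unitary_event_structure N B" "finite (events B)"
    and comm: "\<And>d e. d \<in> events A \<Longrightarrow> e \<in> events B \<Longrightarrow> op A d * op B e = op B e * op A d"
  shows "unitary_event_structure N (par_ues A B)" (is "unitary_event_structure N ?M")
proof -
  note UA = uesD[OF A(1)] and UB = uesD[OF B(1)]
  note EA = event_structureD[OF UA(1)] and EB = event_structureD[OF UB(1)]
  note ss = par_simps
  have M: "event_structure ?M" using A B UA(1) UB(1) by (simp add: event_structure_par)
  note sub = event_structureD(1,5)[OF M]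
  have mev: "d \<in> events ?M" "e \<in> events ?M" if "minimal_conflict ?M d e" for d e
    using minimal_conflictD(1)[OF that] sub by auto
  have mFS: "\<not> minimal_conflict ?M (Fst d) (Snd e)" "\<not> minimal_conflict ?M (Snd e) (Fst d)" for d e
    by (auto simp: minimal_conflict_def ss)
  have mFF: "minimal_conflict ?M (Fst d) (Fst e) \<longleftrightarrow> minimal_conflict A d e" for d e
  proof
    assume "minimal_conflict ?M (Fst d) (Fst e)"
    thus "minimal_conflict A d e" unfolding minimal_conflict_def by (metis event.inject(3) ss(3,7))
  next
    assume m: "minimal_conflict A d e"
    show "minimal_conflict ?M (Fst d) (Fst e)" unfolding minimal_conflict_def
    proof (intro conjI allI impI)
      show "(Fst d, Fst e) \<in> conflict ?M" using m by (simp add: minimal_conflict_def ss)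
    next
      fix d' e' assume h: "(d', Fst d) \<in> causality ?M \<and> (e', Fst e) \<in> causality ?M \<and> (d', e') \<in> conflict ?M"
      have "d' \<in> events ?M" "e' \<in> events ?M" using h sub by auto
      thus "d' = Fst d" "e' = Fst e" using h minimal_conflictD(2)[OF m] by (auto elim!: par_eventE simp: ss)
    qed
  qed
  have mSS: "minimal_conflict ?M (Snd d) (Snd e) \<longleftrightarrow> minimal_conflict B d e" for d e
  proof
    assume "minimal_conflict ?M (Snd d) (Snd e)"
    thus "minimal_conflict B d e" unfolding minimal_conflict_def by (metis event.inject(4) ss(4,8))
  next
    assume m: "minimal_conflict B d e"
    show "minimal_conflict ?M (Snd d) (Snd e)" unfolding minimal_conflict_def
    proof (intro conjI allI impI)
      show "(Snd d, Snd e) \<in> conflict ?M" using m by (simp add: minimal_conflict_def ss)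
    next
      fix d' e' assume h: "(d', Snd d) \<in> causality ?M \<and> (e', Snd e) \<in> causality ?M \<and> (d', e') \<in> conflict ?M"
      have "d' \<in> events ?M" "e' \<in> events ?M" using h sub by auto
      thus "d' = Snd d" "e' = Snd e" using h minimal_conflictD(2)[OF m] by (auto elim!: par_eventE simp: ss)
    qed
  qed
  note mm = mFS mFF mSS
  have clF: "conflict_class ?M (Fst e) = Fst ` conflict_class A e" for e
    using mev(2) by (fastforce simp: conflict_class_def mm elim!: par_eventE)
  have clS: "conflict_class ?M (Snd e) = Snd ` conflict_class B e" for e
    using mev(2) by (fastforce simp: conflict_class_def mm elim!: par_eventE)
  have ops: "op ?M \<circ> Fst = op A" "op ?M \<circ> Snd = op B"
    by (auto simp: par_op_simps)
  show ?thesis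
    unfolding unitary_event_structure_def
  proof (intro conjI M ballI allI impI)
    fix e assume e: "e \<in> events ?M"
    show "unitary_mat (2 ^ N) (op ?M e) \<or> projection_mat (2 ^ N) (op ?M e)"
      using e UA(2) UB(2) by (cases rule: par_eventE) (auto simp: par_op_simps)
    show "finite (conflict_class ?M e)"
      using e UA(5) UB(5) by (cases rule: par_eventE) (auto simp: clF clS)
    show "unitary_mat (2 ^ N) (mat_sum (2 ^ N) (op ?M) (conflict_class ?M e))"
      using e UA(6) UB(6)
      by (cases rule: par_eventE) (auto simp: clF clS mat_sum_image inj_def ops)
  next
    fix d e assume c: "concurrent ?M d e"
    hence "d \<in> events ?M" "e \<in> events ?M" by (auto simp: concurrent_def)
    moreover have FF: "concurrent ?M (Fst d) (Fst e) \<Longrightarrow> concurrent A d e"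
      and SS: "concurrent ?M (Snd d) (Snd e) \<Longrightarrow> concurrent B d e" for d e
      by (auto simp: concurrent_def ss)
    ultimately show "op ?M d * op ?M e = op ?M e * op ?M d"
      using c UA(3) UB(3) comm by (elim par_eventE) (auto simp: par_op_simps)
  next
    fix c d e assume m: "minimal_conflict ?M c d \<and> minimal_conflict ?M d e \<and> c \<noteq> e"
    have "c \<in> events ?M" "d \<in> events ?M" "e \<in> events ?M" using m mev by blast+
    thus "minimal_conflict ?M c e"
      using m UA(4) UB(4) by (elim par_eventE) (auto simp: mm)
  qed
qed

theorem finite_events_interp: "finite (events \<lbrakk>C\<rbrakk>\<^bsub>N\<^esub>)"
  by (induction C) (simp_all add: finite_events_seq finite_events_meas finite_events_par,
    simp_all add: single_ues_def)

theorem op_interp: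
  "e \<in> events \<lbrakk>C\<rbrakk>\<^bsub>N\<^esub> \<Longrightarrow> op \<lbrakk>C\<rbrakk>\<^bsub>N\<^esub> e = label_op N (event_label e)"
proof (induction C arbitrary: e)
  case (Seq C1 C2)
  thus ?case using seq_shape(3)[of e "\<lbrakk>C1\<rbrakk>\<^bsub>N\<^esub>" "\<lbrakk>C2\<rbrakk>\<^bsub>N\<^esub>"] by (auto simp: seq_simps)
next
  case (Meas n C1 C2)
  from Meas.prems[simplified] show ?case
    by (cases rule: meas_eventE) (use Meas.IH in \<open>auto simp: meas_op_simps\<close>)
next
  case (Par C1 C2)
  from Par.prems[simplified] show ?case
    by (cases rule: par_eventE) (use Par.IH in \<open>auto simp: par_op_simps\<close>)
qed (auto simp: single_ues_def)

lemma label_qubits_interp: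
  "e \<in> events \<lbrakk>C\<rbrakk>\<^bsub>N\<^esub> \<Longrightarrow> label_qubits (event_label e) \<subseteq> qubits C"
proof (induction C arbitrary: e)
  case (Seq C1 C2)
  thus ?case using seq_shape(3)[of e "\<lbrakk>C1\<rbrakk>\<^bsub>N\<^esub>" "\<lbrakk>C2\<rbrakk>\<^bsub>N\<^esub>"] by (fastforce simp: seq_simps)
next
  case (Meas n C1 C2)
  from Meas.prems[simplified] show ?case
    by (cases rule: meas_eventE) (use Meas.IH in \<open>fastforce+\<close>)
next
  case (Par C1 C2)
  from Par.prems[simplified] show ?case
    by (cases rule: par_eventE) (use Par.IH in \<open>fastforce+\<close>)
qed (auto simp: single_ues_def)

theorem unitary_event_structure_interp:
  "wf_com N C \<Longrightarrow> unitary_event_structure N \<lbrakk>C\<rbrakk>\<^bsub>N\<^esub>"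
proof (induction C)
  case (Par C1 C2)
  have "op \<lbrakk>C1\<rbrakk>\<^bsub>N\<^esub> d * op \<lbrakk>C2\<rbrakk>\<^bsub>N\<^esub> e = op \<lbrakk>C2\<rbrakk>\<^bsub>N\<^esub> e * op \<lbrakk>C1\<rbrakk>\<^bsub>N\<^esub> d"
    if "d \<in> events \<lbrakk>C1\<rbrakk>\<^bsub>N\<^esub>" "e \<in> events \<lbrakk>C2\<rbrakk>\<^bsub>N\<^esub>" for d e
  proof -
    have "label_qubits (event_label d) \<inter> label_qubits (event_label e) = {}"
      using label_qubits_interp[OF that(1)] label_qubits_interp[OF that(2)] Par.prems by auto
    from label_op_commute[OF this] show ?thesis using that by (simp add: op_interp)
  qed
  thus ?case using Par by (simp add: ues_par finite_events_interp)
qed (simp_all add: ues_single unitary_one unitary_on_qubits ues_seq ues_meas finite_events_interp)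

end

(* By induction on C, the trace is read off an event sequence all of whose prefixes are
   configurations. For sequential composition the induction needs one more invariant: a run that
   terminates fills a maximal configuration, which is then the index of the copy of the second
   component in which the run goes on. A run of a parallel composition is a shuffle of a run of
   each component. *)
theory Submission
  imports Defs
begin

section \<open>Event sequences through configurations\<close>

text \<open>A covering chain without its list of sets: the prefixes of \<open>es\<close> determine
  them. For \<open>i\<close> beyond the length the prefix is \<open>es\<close> itself, so no bound
  on \<open>i\<close> has to be carried along.\<close>

definition config_seq :: "('e, 'z) es_scheme \<Rightarrow> 'e list \<Rightarrow> bool" where
  "config_seq E es \<longleftrightarrow> distinct es \<and> (\<forall>i. configuration E (set (take i es)))"

lemma config_seq_Nil [simp]: "config_seq E []"
  by (simp add: config_seq_def configuration_def)

lemma config_seq_configuration: "config_seq E es \<Longrightarrow> configuration E (set es)"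
  unfolding config_seq_def by (metis take_all_iff order_refl)

text \<open>The chain consists of the sets of prefixes; distinctness of \<open>es\<close> makes
  every added event new.\<close>

lemma config_seq_covering_chain:
  assumes "config_seq E es"
  shows "covering_chain E (set es) es"
  unfolding covering_chain_def
proof (intro exI conjI allI impI)
  let ?xs = "map (\<lambda>i. set (take i es)) [0..<Suc (length es)]"
  show "length ?xs = Suc (length es)" "?xs ! 0 = {}" "?xs ! length es = set es"
    by (simp_all add: nth_append del: upt_Suc)
  show "configuration E (?xs ! i)" if "i \<le> length es" for i
    using assms that by (simp add: config_seq_def del: upt_Suc)
  fix i assume i: "i < length es"
  have "distinct (take (Suc i) es)" using assms by (simp add: config_seq_def)
  with i show "es ! i \<notin> ?xs ! i" by (simp add: take_Suc_conv_app_nth del: upt_Suc)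
  from i show "?xs ! Suc i = insert (es ! i) (?xs ! i)"
    by (simp add: take_Suc_conv_app_nth del: upt_Suc)
qed

text \<open>Prefixes inside \<open>ds\<close> are covered by \<open>ds\<close>; any longer one
  contains all of \<open>ds\<close> and the image of a prefix of \<open>es\<close>, so
  \<open>conf\<close> concerns only the full set of \<open>ds\<close>. Here \<open>h\<close> tags
  the events of a component that starts after \<open>ds\<close>.\<close>

lemma config_seq_append_map:
  assumes ds: "config_seq F ds" and es: "config_seq E es" and h: "inj h"
    and disj: "set ds \<inter> range h = {}"
    and conf: "\<And>x. configuration E x \<Longrightarrow> configuration F (set ds \<union> h ` x)"
  shows "config_seq F (ds @ map h es)"
  unfolding config_seq_def
proof (intro conjI allI)
  show "distinct (ds @ map h es)"
    using ds es disj inj_on_subset[OF h] by (auto simp: config_seq_def distinct_map)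
  show "configuration F (set (take i (ds @ map h es)))" for i
  proof (cases "i \<le> length ds")
    case True
    thus ?thesis using ds by (simp add: config_seq_def)
  next
    case False
    thus ?thesis using es conf by (simp add: config_seq_def take_map)
  qed
qed

section \<open>Shuffles: prefixes and lifting along a map\<close>

text \<open>The numbers \<open>j\<close> and \<open>k\<close> count the letters of the prefix taken
  from each list; removing the head of \<open>zs\<close> lowers one of them by one.\<close>

lemma take_shuffles:
  assumes "zs \<in> shuffles xs ys"
  shows "\<exists>j k. take i zs \<in> shuffles (take j xs) (take k ys)"
  using assms
proof (induction i arbitrary: xs ys zs)
  case 0
  have "take 0 zs \<in> shuffles (take 0 xs) (take 0 ys)" by simp
  thus ?case by blast
next
  case (Suc i)
  show ?case
  proof (cases zs)
    case Nil
    thus ?thesis using Suc.prems by auto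
  next
    case (Cons z zs')
    with Suc.prems consider
      (L) xs' where "xs = z # xs'" "zs' \<in> shuffles xs' ys"
      | (R) ys' where "ys = z # ys'" "zs' \<in> shuffles xs ys'"
      by (auto simp: Cons_in_shuffles_iff neq_Nil_conv)
    thus ?thesis
    proof cases
      case L
      with Suc.IH obtain j k where "take i zs' \<in> shuffles (take j xs') (take k ys)" by blast
      hence "take (Suc i) zs \<in> shuffles (take (Suc j) xs) (take k ys)"
        using L Cons by (simp add: Cons_in_shuffles_leftI)
      thus ?thesis by blast
    next
      case R
      with Suc.IH obtain j k where "take i zs' \<in> shuffles (take j xs) (take k ys')" by blast
      hence "take (Suc i) zs \<in> shuffles (take j xs) (take (Suc k) ys)"
        using R Cons by (simp add: Cons_in_shuffles_rightI)
      thus ?thesis by blast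
    qed
  qed
qed

text \<open>Following which list each letter of \<open>zs\<close> comes from rebuilds the shuffle
  upstairs. No injectivity of \<open>f\<close> is assumed, as distinct events may share a
  label.\<close>

lemma shuffles_mapE:
  assumes "zs \<in> shuffles (map f xs) (map f ys)"
  obtains ws where "ws \<in> shuffles xs ys" "map f ws = zs"
  using assms
proof (induction zs arbitrary: xs ys thesis)
  case Nil
  thus ?case by simp
next
  case (Cons z zs)
  from Cons.prems(2) consider
    (L) x xs' where "xs = x # xs'" "f x = z" "zs \<in> shuffles (map f xs') (map f ys)"
    | (R) y ys' where "ys = y # ys'" "f y = z" "zs \<in> shuffles (map f xs) (map f ys')"
    by (cases xs; cases ys) (auto simp: Cons_in_shuffles_iff)
  thus ?case
  proof cases
    case L
    obtain ws where "ws \<in> shuffles xs' ys" "map f ws = zs" by (rule Cons.IH[OF _ L(3)])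
    thus ?thesis using L Cons.prems(1)[of "x # ws"] by (simp add: Cons_in_shuffles_leftI)
  next
    case R
    obtain ws where "ws \<in> shuffles xs ys'" "map f ws = zs" by (rule Cons.IH[OF _ R(3)])
    thus ?thesis using R Cons.prems(1)[of "y # ws"] by (simp add: Cons_in_shuffles_rightI)
  qed
qed


section \<open>Configurations of the composite event structures\<close>

text \<open>Restricts a configuration of a composite structure to a component embedded by
  \<open>h\<close>. Maximality of composites is reduced to maximality of components in this
  way.\<close>

lemma configuration_vimage:
  assumes "configuration F z"
    and "\<And>e. h e \<in> z \<Longrightarrow> h e \<in> events F \<Longrightarrow> e \<in> events E"
    and "\<And>d e. h e \<in> z \<Longrightarrow> (d, e) \<in> causality E \<Longrightarrow> (h d, h e) \<in> causality F"
    and "\<And>d e. (d, e) \<in> conflict E \<Longrightarrow> (h d, h e) \<in> conflict F"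
  shows "configuration E (h -` z)"
  using assms unfolding configuration_def vimage_def by blast

lemma maximal_configuration_eqI:
  "maximal_configuration E x \<Longrightarrow> configuration E y \<Longrightarrow> x \<subseteq> y \<Longrightarrow> y = x"
  by (simp add: maximal_configuration_def)

section \<open>Sequential composition\<close>

lemma configuration_seq_Fst:
  "configuration A x \<Longrightarrow> configuration (seq_ues A B) (Fst ` x)"
  by (auto simp: configuration_def seq_ues_def)

text \<open>What lies below an event of the copy indexed by \<open>x\<close> is in \<open>x\<close>
  or in the same copy, so the union is down-closed. A conflict inherited through the index would be
  a conflict inside \<open>x\<close>.\<close>

lemma configuration_seq_After:
  assumes "maximal_configuration A (fset x)" "configuration B y"
  shows "configuration (seq_ues A B) (Fst ` fset x \<union> (\<lambda>e. After e x) ` y)"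
    (is "configuration ?S ?z")
proof -
  note mx = maximal_configurationD[OF assms(1)]
  have y: "y \<subseteq> events B" "\<And>d e. e \<in> y \<Longrightarrow> (d, e) \<in> causality B \<Longrightarrow> d \<in> y"
    "\<And>d e. d \<in> y \<Longrightarrow> e \<in> y \<Longrightarrow> (d, e) \<notin> conflict B"
    using assms(2) unfolding configuration_def by blast+
  show ?thesis
    unfolding configuration_def
  proof (intro conjI allI ballI impI)
    show "?z \<subseteq> events ?S" using mx(1) y(1) assms(1) by (auto simp: seq_simps)
    show "d \<in> ?z" if "e \<in> ?z \<and> (d, e) \<in> causality ?S" for d e
      using that[THEN conjunct2]
      by (cases rule: seq_causalityE) (use that mx(2) y(2) in auto)
    show "(d, e) \<notin> conflict ?S" if "d \<in> ?z" "e \<in> ?z" for d e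
      using that mx(3) y(3) by (auto simp: seq_simps seq_conflict_After)
  qed
qed

text \<open>A larger configuration restricts to one of \<open>A\<close> containing \<open>x\<close>
  and to one of \<open>B\<close> containing \<open>y\<close>, so it adds nothing there; what remains
  is to exclude events of other copies.\<close>

lemma maximal_configuration_seq:
  assumes x: "maximal_configuration A (fset x)" and y: "maximal_configuration B y"
  shows "maximal_configuration (seq_ues A B) (Fst ` fset x \<union> (\<lambda>e. After e x) ` y)"
    (is "maximal_configuration ?S ?z")
  unfolding maximal_configuration_def
proof (intro conjI allI impI)
  show "configuration ?S ?z"
    using x y configuration_seq_After by (auto simp: maximal_configuration_def)
  fix z assume z: "configuration ?S z \<and> ?z \<subseteq> z"
  hence ev: "z \<subseteq> events ?S" and down: "\<And>d e. e \<in> z \<Longrightarrow> (d, e) \<in> causality ?S \<Longrightarrow> d \<in> z"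
    unfolding configuration_def by blast+
  have "configuration A (Fst -` z)"
    by (rule configuration_vimage[of ?S]) (use z in \<open>simp_all add: seq_simps\<close>)
  moreover have "fset x \<subseteq> Fst -` z" using z by auto
  ultimately have F: "Fst -` z = fset x" by (rule maximal_configuration_eqI[OF x])
  have "configuration B ((\<lambda>e. After e x) -` z)"
    by (rule configuration_vimage[of ?S]) (use z x in \<open>simp_all add: seq_simps seq_conflict_After\<close>)
  moreover have "y \<subseteq> (\<lambda>e. After e x) -` z" using z by auto
  ultimately have Y: "(\<lambda>e. After e x) -` z = y" by (rule maximal_configuration_eqI[OF y])
  \<comment> \<open>An event of the copy \<open>x'\<close> forces \<open>x'\<close> into
    \<open>z\<close> by down-closure, hence into \<open>x\<close>; maximality of \<open>x'\<close>
    turns the inclusion into equality.\<close>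
  have X: "x' = x" if a: "After e x' \<in> z" for e x'
  proof -
    have m: "maximal_configuration A (fset x')" "e \<in> events B" using a ev by (auto simp: seq_simps)
    have "Fst d \<in> z" if "d \<in> fset x'" for d
      using down[OF a, of "Fst d"] that m by (simp add: seq_simps)
    hence "fset x' \<subseteq> fset x" using F by auto
    hence "fset x = fset x'" using m x unfolding maximal_configuration_def by blast
    thus ?thesis by (simp add: fset_inject)
  qed
  show "z = ?z"
  proof
    show "?z \<subseteq> z" using z by simp
    show "z \<subseteq> ?z"
    proof
      fix e assume e: "e \<in> z"
      hence "e \<in> events ?S" using ev by blast
      thus "e \<in> ?z" using e F Y X by (cases rule: seq_eventE) auto
    qed
  qed
qed

section \<open>Measurement\<close>

lemma configuration_meas_Fst:
  "configuration A x \<Longrightarrow> configuration (meas_ues N n A B) (insert (Tau False n) (Fst ` x))"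
  by (auto simp: configuration_def meas_ues_def Let_def)

lemma configuration_meas_Snd:
  "configuration B x \<Longrightarrow> configuration (meas_ues N n A B) (insert (Tau True n) (Snd ` x))"
  by (auto simp: configuration_def meas_ues_def Let_def)

lemma configuration_meas_vimage:
  assumes "configuration (meas_ues N n A B) z"
  shows "configuration A (Fst -` z)" "configuration B (Snd -` z)"
  by (rule configuration_vimage[OF assms]; simp add: meas_simps)+

text \<open>The outcome event conflicts with everything on the other side, so a larger configuration
  stays in this branch, where maximality of \<open>x\<close> applies.\<close>

lemma maximal_configuration_meas_Fst:
  assumes x: "maximal_configuration A x"
  shows "maximal_configuration (meas_ues N n A B) (insert (Tau False n) (Fst ` x))"
    (is "maximal_configuration ?M ?x")
  unfolding maximal_configuration_def
proof (intro conjI allI impI)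
  show "configuration ?M ?x"
    using x configuration_meas_Fst by (auto simp: maximal_configuration_def)
  fix z assume z: "configuration ?M z \<and> ?x \<subseteq> z"
  have "x \<subseteq> Fst -` z" using z by auto
  hence F: "Fst -` z = x"
    using maximal_configuration_eqI[OF x] configuration_meas_vimage(1)[OF conjunct1[OF z]] by simp
  have "e \<in> ?x" if "e \<in> z" for e
  proof -
    have "e \<in> events ?M" "(Tau False n, e) \<notin> conflict ?M"
      using z that unfolding configuration_def by auto
    thus ?thesis using that F by (cases rule: meas_eventE) (auto simp: meas_simps)
  qed
  thus "z = ?x" using z by blast
qed

lemma maximal_configuration_meas_Snd:
  assumes x: "maximal_configuration B x"
  shows "maximal_configuration (meas_ues N n A B) (insert (Tau True n) (Snd ` x))"
    (is "maximal_configuration ?M ?x")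
  unfolding maximal_configuration_def
proof (intro conjI allI impI)
  show "configuration ?M ?x"
    using x configuration_meas_Snd by (auto simp: maximal_configuration_def)
  fix z assume z: "configuration ?M z \<and> ?x \<subseteq> z"
  have "x \<subseteq> Snd -` z" using z by auto
  hence F: "Snd -` z = x"
    using maximal_configuration_eqI[OF x] configuration_meas_vimage(2)[OF conjunct1[OF z]] by simp
  have "e \<in> ?x" if "e \<in> z" for e
  proof -
    have "e \<in> events ?M" "(Tau True n, e) \<notin> conflict ?M"
      using z that unfolding configuration_def by auto
    thus ?thesis using that F by (cases rule: meas_eventE) (auto simp: meas_simps)
  qed
  thus "z = ?x" using z by blast
qed

section \<open>Parallel composition\<close>

lemma configuration_par:
  "configuration A x \<Longrightarrow> configuration B y \<Longrightarrow> configuration (par_ues A B) (Fst ` x \<union> Snd ` y)"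
  by (auto simp: configuration_def par_ues_def)

lemma configuration_par_vimage:
  assumes "configuration (par_ues A B) z"
  shows "configuration A (Fst -` z)" "configuration B (Snd -` z)"
  by (rule configuration_vimage[OF assms]; simp add: par_simps)+

lemma maximal_configuration_par:
  assumes x: "maximal_configuration A x" and y: "maximal_configuration B y"
  shows "maximal_configuration (par_ues A B) (Fst ` x \<union> Snd ` y)"
    (is "maximal_configuration ?M ?z")
  unfolding maximal_configuration_def
proof (intro conjI allI impI)
  show "configuration ?M ?z"
    using x y configuration_par by (auto simp: maximal_configuration_def)
  fix z assume z: "configuration ?M z \<and> ?z \<subseteq> z"
  have "x \<subseteq> Fst -` z" "y \<subseteq> Snd -` z" using z by auto
  hence *: "Fst -` z = x" "Snd -` z = y"
    using maximal_configuration_eqI[OF x] maximal_configuration_eqI[OF y]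
      configuration_par_vimage[OF conjunct1[OF z]] by simp_all
  have "e \<in> ?z" if "e \<in> z" for e
  proof -
    have "e \<in> events ?M" using z that unfolding configuration_def by auto
    thus ?thesis using that * by (cases rule: par_eventE) auto
  qed
  hence "z \<subseteq> ?z" by (rule subsetI)
  with z show "z = ?z" by (simp only: subset_antisym)
qed

text \<open>A prefix of a shuffle is a shuffle of prefixes, so its set is the disjoint union of a
  configuration from each side.\<close>

lemma config_seq_par:
  assumes ds: "config_seq A ds" and es: "config_seq B es"
    and zs: "zs \<in> shuffles (map Fst ds) (map Snd es)"
  shows "config_seq (par_ues A B) zs"
  unfolding config_seq_def
proof (intro conjI allI)
  have "distinct (map Fst ds)" "distinct (map Snd es)"
    using ds es by (simp_all add: config_seq_def distinct_map inj_on_def)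
  moreover have "set (map Fst ds) \<inter> set (map Snd es) = {}" by auto
  ultimately show "distinct zs" using zs by (rule distinct_disjoint_shuffles)
  fix i
  obtain j k where "take i zs \<in> shuffles (take j (map Fst ds)) (take k (map Snd es))"
    using take_shuffles[OF zs] by blast
  hence "set (take i zs) = Fst ` set (take j ds) \<union> Snd ` set (take k es)"
    by (simp add: set_shuffles take_map)
  thus "configuration (par_ues A B) (set (take i zs))"
    using ds es by (simp add: config_seq_def configuration_par)
qed


section \<open>Runs of composite commands\<close>

text \<open>The rule \<open>cons\<close> needs a residual command after the first step, so only
  \<open>single\<close> can apply.\<close>

lemma steps_atomic:
  assumes "C \<twoheadrightarrow>[\<omega>] R" "\<And>l R'. C \<rightarrow>[l] R' \<Longrightarrow> l = l0 \<and> R' = \<checkmark>"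
  shows "\<omega> = [l0]"
  using assms by (cases rule: steps.cases) auto

text \<open>\<open>Switch\<close> is the run that stops exactly when the first component finishes;
  it is separate from \<open>Second\<close> because \<open>steps\<close> has no empty run of
  \<open>C2\<close>. Only \<open>Second\<close> can end in \<checkmark>.\<close>

lemma steps_Seq:
  assumes "Seq C1 C2 \<twoheadrightarrow>[\<omega>] R"
  obtains (First) C1' where "C1 \<twoheadrightarrow>[\<omega>] Run C1'" "R = Run (Seq C1' C2)"
  | (Switch) "C1 \<twoheadrightarrow>[\<omega>] \<checkmark>" "R = Run C2"
  | (Second) \<omega>1 \<omega>2 where "\<omega> = \<omega>1 @ \<omega>2" "C1 \<twoheadrightarrow>[\<omega>1] \<checkmark>" "C2 \<twoheadrightarrow>[\<omega>2] R"
  using assms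
proof (induction "Seq C1 C2" \<omega> R arbitrary: C1 thesis rule: steps.induct)
  case (single l R)
  from single.hyps show ?case
    by (cases rule: step.cases) (use single.prems steps.single in blast)+
next
  case (cons l C'' \<omega> R)
  from cons.hyps(1) show ?case
  proof (cases rule: step.cases)
    case (seq C1')
    from cons.hyps(3)[OF seq(1)] show ?thesis
      using seq(2) cons.prems steps.cons by (metis append_Cons)
  next
    \<comment> \<open>The first component finishes with \<open>l\<close>, so \<open>Second\<close>
      applies with \<open>\<omega>1 = [l]\<close>.\<close>
    case seq_done
    thus ?thesis using cons.prems(3)[of "[l]" \<omega>] cons.hyps(2) steps.single by simp
  qed
qed

lemma steps_Meas:
  assumes "Meas n C1 C2 \<twoheadrightarrow>[\<omega>] R"
  obtains (Now) b where "\<omega> = [LProj b n]" "R \<noteq> \<checkmark>"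
  | (Left) \<omega>' where "\<omega> = LProj False n # \<omega>'" "C1 \<twoheadrightarrow>[\<omega>'] R"
  | (Right) \<omega>' where "\<omega> = LProj True n # \<omega>'" "C2 \<twoheadrightarrow>[\<omega>'] R"
  using assms by (cases rule: steps.cases) (auto elim: step.cases)

text \<open>The steps relation contains no empty runs, but a component of a parallel composition may
  stay idle.\<close>

definition idle_steps :: "com \<Rightarrow> label list \<Rightarrow> residual \<Rightarrow> bool" where
  "idle_steps C \<omega> R \<longleftrightarrow> C \<twoheadrightarrow>[\<omega>] R \<or> \<omega> = [] \<and> R = Run C"

lemma idle_steps_Nil: "idle_steps C [] (Run C)"
  by (simp add: idle_steps_def)

lemma idle_steps_Cons: "C \<rightarrow>[l] Run C' \<Longrightarrow> idle_steps C' \<omega> R \<Longrightarrow> idle_steps C (l # \<omega>) R"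
  by (auto simp: idle_steps_def intro: steps.intros)

lemma idle_steps_single: "C \<rightarrow>[l] R \<Longrightarrow> idle_steps C [l] R"
  by (simp add: idle_steps_def steps.single)

text \<open>Each step is charged to the component that moves. Only completion of \<open>R\<close> is
  related to \<open>R1\<close> and \<open>R2\<close>, since only completed runs have to fill maximal
  configurations.\<close>

lemma steps_Par:
  assumes "Par C1 C2 \<twoheadrightarrow>[\<omega>] R"
  shows "\<exists>\<omega>1 \<omega>2 R1 R2. \<omega> \<in> shuffles \<omega>1 \<omega>2 \<and> idle_steps C1 \<omega>1 R1 \<and> idle_steps C2 \<omega>2 R2
    \<and> (R = \<checkmark> \<longrightarrow> R1 = \<checkmark> \<and> R2 = \<checkmark>)"
  using assms
proof (induction "Par C1 C2" \<omega> R arbitrary: C1 C2 rule: steps.induct)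
  case (single l R)
  have L: "[l] \<in> shuffles [l] []" "[l] \<in> shuffles [] [l]" by simp_all
  from single.hyps show ?case
    by (cases rule: step.cases) (use L idle_steps_single idle_steps_Nil in blast)+
next
  case (cons l C'' \<omega> R)
  from cons.hyps(1) show ?case
  proof (cases rule: step.cases)
    case (par_left C1')
    from cons.hyps(3)[OF par_left(1)] show ?thesis
      using idle_steps_Cons[OF par_left(2)] Cons_in_shuffles_leftI by metis
  next
    case par_left_done
    \<comment> \<open>The finished side is dropped, so the rest of the run belongs to
      \<open>C2\<close> alone and the induction hypothesis is not involved.\<close>
    have "l # \<omega> \<in> shuffles [l] \<omega>" by (simp add: Cons_in_shuffles_leftI)
    thus ?thesis using par_left_done cons.hyps(2) idle_steps_single
      by (metis idle_steps_def)
  next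
    case (par_right C2')
    from cons.hyps(3)[OF par_right(1)] show ?thesis
      using idle_steps_Cons[OF par_right(2)] Cons_in_shuffles_rightI by metis
  next
    case par_right_done
    have "l # \<omega> \<in> shuffles \<omega> [l]" by (simp add: Cons_in_shuffles_rightI)
    thus ?thesis using par_right_done cons.hyps(2) idle_steps_single
      by (metis idle_steps_def)
  qed
qed


section \<open>Runs as event sequences\<close>

lemma single_ues_run:
  "config_seq (single_ues e A) [e] \<and> maximal_configuration (single_ues e A) (set [e])"
proof -
  have "configuration (single_ues e A) x \<longleftrightarrow> x \<subseteq> {e}" for x
    by (auto simp: configuration_def single_ues_def)
  thus ?thesis
    by (auto simp: config_seq_def maximal_configuration_def dest: in_set_takeD)
qed

text \<open>Maximality is carried through every constructor because any command may occur as the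
  first component of a sequential composition.\<close>

lemma steps_config_seq:
  assumes "C \<twoheadrightarrow>[\<omega>] R"
  shows "\<exists>es. config_seq \<lbrakk>C\<rbrakk>\<^bsub>N\<^esub> es \<and> map event_label es = \<omega>
    \<and> (R = \<checkmark> \<longrightarrow> maximal_configuration \<lbrakk>C\<rbrakk>\<^bsub>N\<^esub> (set es))"
  using assms
proof (induction C arbitrary: \<omega> R)
  case Skip
  have "\<omega> = [LSkip]" using Skip by (rule steps_atomic) (auto elim: step.cases)
  thus ?case using single_ues_run[of Ev_Skip] by (intro exI[of _ "[Ev_Skip]"]) simp
next
  case (Gate U ns)
  have "\<omega> = [LGate U ns]" using Gate by (rule steps_atomic) (auto elim: step.cases)
  thus ?case using single_ues_run[of "Ev_Gate U ns"] by (intro exI[of _ "[Ev_Gate U ns]"]) simp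
next
  case (Seq C1 C2)
  let ?A = "\<lbrakk>C1\<rbrakk>\<^bsub>N\<^esub>" and ?B = "\<lbrakk>C2\<rbrakk>\<^bsub>N\<^esub>"
  \<comment> \<open>The empty initial list specializes the append lemma to plain tagging by
    \<open>Fst\<close>.\<close>
  have first: "config_seq (seq_ues ?A ?B) (map Fst es)" if "config_seq ?A es" for es
    using config_seq_append_map[of "seq_ues ?A ?B" "[]" ?A es Fst] that
    by (simp add: inj_def configuration_seq_Fst)
  have labels: "event_label \<circ> Fst = event_label" "event_label \<circ> (\<lambda>e. After e X) = event_label" for X
    by auto
  from Seq.prems show ?case
  proof (cases rule: steps_Seq)
    case (First C1')
    from Seq.IH(1)[OF First(1)] obtain es where "config_seq ?A es" "map event_label es = \<omega>"
      by blast
    thus ?thesis using first First by (intro exI[of _ "map Fst es"]) (simp add: labels)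
  next
    case Switch
    from Seq.IH(1)[OF Switch(1)] obtain es where "config_seq ?A es" "map event_label es = \<omega>"
      by blast
    thus ?thesis using first Switch by (intro exI[of _ "map Fst es"]) (simp add: labels)
  next
    case (Second \<omega>1 \<omega>2)
    from Seq.IH(1)[OF Second(2)] obtain ds where ds: "config_seq ?A ds" "map event_label ds = \<omega>1"
      "maximal_configuration ?A (set ds)" by blast
    from Seq.IH(2)[OF Second(3)] obtain es where es: "config_seq ?B es" "map event_label es = \<omega>2"
      "R = \<checkmark> \<longrightarrow> maximal_configuration ?B (set es)" by blast
    \<comment> \<open>The maximal configuration filled by the run of \<open>C1\<close>, as a finite
      set: the index of the copy of \<open>?B\<close> that runs next.\<close>
    define X where "X = fset_of_list ds"
    have X: "fset X = set ds" by (simp add: X_def fset_of_list.rep_eq)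
    have "config_seq (seq_ues ?A ?B) (map Fst ds @ map (\<lambda>e. After e X) es)"
      using first[OF ds(1)] es(1)
    proof (rule config_seq_append_map)
      show "configuration (seq_ues ?A ?B) (set (map Fst ds) \<union> (\<lambda>e. After e X) ` x)"
        if "configuration ?B x" for x
        using configuration_seq_After[of ?A X ?B x] ds(3) that by (simp add: X)
    qed (auto simp: inj_def)
    moreover have "R = \<checkmark> \<longrightarrow>
        maximal_configuration (seq_ues ?A ?B) (set (map Fst ds @ map (\<lambda>e. After e X) es))"
      using maximal_configuration_seq[of ?A X ?B "set es"] ds(3) es(3) by (simp add: X)
    ultimately show ?thesis
      using Second(1) ds(2) es(2)
      by (intro exI[of _ "map Fst ds @ map (\<lambda>e. After e X) es"]) (simp add: labels)
  qed
next
  case (Meas n C1 C2)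
  let ?A = "\<lbrakk>C1\<rbrakk>\<^bsub>N\<^esub>" and ?B = "\<lbrakk>C2\<rbrakk>\<^bsub>N\<^esub>"
  let ?M = "meas_ues N n ?A ?B"
  have labels: "event_label \<circ> Fst = event_label" "event_label \<circ> Snd = event_label"
    by auto
  have empty: "configuration E {}" for E :: "event ues"
    by (simp add: configuration_def)
  have tau: "config_seq ?M [Tau b n]" for b
    unfolding config_seq_def
  proof (intro conjI allI)
    \<comment> \<open>This is the image of the empty configuration of the chosen branch.\<close>
    have "configuration ?M {Tau b n}"
      using configuration_meas_Fst[OF empty] configuration_meas_Snd[OF empty] by (cases b) auto
    thus "configuration ?M (set (take i [Tau b n]))" for i
      by (cases i) (simp_all add: empty)
  qed simp
  from Meas.prems show ?case
  proof (cases rule: steps_Meas)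
    case (Now b)
    thus ?thesis using tau[of b] by (intro exI[of _ "[Tau b n]"]) simp
  next
    case (Left \<omega>')
    from Meas.IH(1)[OF Left(2)] obtain es where es: "config_seq ?A es" "map event_label es = \<omega>'"
      "R = \<checkmark> \<longrightarrow> maximal_configuration ?A (set es)" by blast
    have "config_seq ?M ([Tau False n] @ map Fst es)"
      using tau es(1) by (rule config_seq_append_map) (auto simp: inj_def configuration_meas_Fst)
    thus ?thesis using Left(1) es(2,3) maximal_configuration_meas_Fst
      by (intro exI[of _ "[Tau False n] @ map Fst es"]) (simp add: labels)
  next
    case (Right \<omega>')
    from Meas.IH(2)[OF Right(2)] obtain es where es: "config_seq ?B es" "map event_label es = \<omega>'"
      "R = \<checkmark> \<longrightarrow> maximal_configuration ?B (set es)" by blast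
    have "config_seq ?M ([Tau True n] @ map Snd es)"
      using tau es(1) by (rule config_seq_append_map) (auto simp: inj_def configuration_meas_Snd)
    thus ?thesis using Right(1) es(2,3) maximal_configuration_meas_Snd
      by (intro exI[of _ "[Tau True n] @ map Snd es"]) (simp add: labels)
  qed
next
  case (Par C1 C2)
  let ?A = "\<lbrakk>C1\<rbrakk>\<^bsub>N\<^esub>" and ?B = "\<lbrakk>C2\<rbrakk>\<^bsub>N\<^esub>"
  from steps_Par[OF Par.prems] obtain \<omega>1 \<omega>2 R1 R2 where \<omega>: "\<omega> \<in> shuffles \<omega>1 \<omega>2"
    and idle: "idle_steps C1 \<omega>1 R1" "idle_steps C2 \<omega>2 R2"
    and R: "R = \<checkmark> \<longrightarrow> R1 = \<checkmark> \<and> R2 = \<checkmark>" by blast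
  \<comment> \<open>An idle component contributes the empty sequence; its residual is not
    \<checkmark>, so the maximality claim is vacuous.\<close>
  obtain ds where ds: "config_seq ?A ds" "map event_label ds = \<omega>1"
      "R1 = \<checkmark> \<longrightarrow> maximal_configuration ?A (set ds)"
    using idle(1) Par.IH(1) config_seq_Nil unfolding idle_steps_def by fastforce
  obtain es where es: "config_seq ?B es" "map event_label es = \<omega>2"
      "R2 = \<checkmark> \<longrightarrow> maximal_configuration ?B (set es)"
    using idle(2) Par.IH(2) config_seq_Nil unfolding idle_steps_def by fastforce
  \<comment> \<open>Tagging leaves labels unchanged, so the shuffle of labels can be lifted to
    tagged events, where the two sides are disjoint.\<close>
  have "\<omega> \<in> shuffles (map event_label (map Fst ds)) (map event_label (map Snd es))"
    using \<omega> ds(2) es(2) by (simp add: comp_def)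
  then obtain zs where zs: "zs \<in> shuffles (map Fst ds) (map Snd es)" "map event_label zs = \<omega>"
    by (rule shuffles_mapE)
  have "set zs = Fst ` set ds \<union> Snd ` set es" using zs(1) by (simp add: set_shuffles)
  thus ?case using config_seq_par[OF ds(1) es(1) zs(1)] zs(2) R ds(3) es(3)
    by (auto intro!: exI[of _ zs] maximal_configuration_par)
qed

theorem mainTheorem5:
  fixes N :: nat and C :: com and C' :: residual and \<omega> :: "label list"
  assumes "wf_com N C"
    and "C \<twoheadrightarrow>[\<omega>] C'"
  shows "\<exists>x es. configuration (\<lbrakk>C\<rbrakk>\<^bsub>N\<^esub>) x \<and> finite x
    \<and> covering_chain (\<lbrakk>C\<rbrakk>\<^bsub>N\<^esub>) x es \<and> map event_label es = \<omega>"
  \<comment> \<open>The configuration is \<open>set es\<close>, which is finite because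
    \<open>es\<close> is a list.\<close>
  using steps_config_seq[OF assms(2)] config_seq_configuration config_seq_covering_chain
  by (metis finite_set)

end
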